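(* For an arbitrary simplicial complex $\mathcal{K}$, the maps $\Psi_{\mathcal{K}}:L(\Omega,\mathcal{K})\to|\mathcal{K}|_1$ and $\overline{\Psi}_{\mathcal{K}}:\bar{L}(\Omega,\mathcal{K})\to\overline{|\mathcal{K}|_1}$ are Serre fibrations and weak homotopy equivalences. If $\mathcal{K}$ is finite, then $\Psi_{\mathcal{K}}$ and $\overline{\Psi}_{\mathcal{K}}$ are Hurewicz fibrations and homotopy equivalences.
   Context: $(\Omega,\lambda)$ is a nonatomic standard probability space (isomorphic modulo null sets to $[0,1]$ with Lebesgue measure). For a set $S$, endowed with the discrete metric ($d(s,s')=1$ if $s\neq s'$) and its Borel $\sigma$-algebra (all subsets), $L(\Omega,S)$ is the set of measurable maps $\Omega\to S$ modulo almost everywhere equality, with the metric $d(f,g)=\lambda(\{t : f(t)\neq g(t)\})$. The essential image of $f\in L(\Omega,S)$ is $f(\Omega)=\{s\in S : \lambda(f^{-1}(\{s\}))>0\}$. A simplicial complex is a collection $\mathcal{K}$ of nonempty finite subsets of a set $S$ such that every nonempty subset of an element of $\mathcal{K}$ is in $\mathcal{K}$. $L(\Omega,\mathcal{K})=\{f\in L(\Omega,S) : f(\Omega)\in\mathcal{K}\}$, and $\bar{L}(\Omega,\mathcal{K})$ is its closure in $L(\Omega,S)$, both with the induced metric. $|\mathcal{K}|_1=\{\alpha:S\to[0,1] : \{s : \alpha(s)>0\}\in\mathcal{K},\ \sum_{s\in S}\alpha(s)=1\}$ with the metric $d_1(\alpha,\beta)=\sum_{s\in S}|\alpha(s)-\beta(s)|$;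 $\overline{|\mathcal{K}|_1}$ is its metric completion, which identifies with the set of $\alpha:S\to[0,1]$ with $\sum_s\alpha(s)=1$ such that every nonempty finite subset of $\{s : \alpha(s)\neq 0\}$ belongs to $\mathcal{K}$, with the same formula for the metric. The law maps $\Psi_{\mathcal{K}}$ and $\overline{\Psi}_{\mathcal{K}}$ send $f$ to $s\mapsto\lambda(f^{-1}(\{s\}))$. A Serre fibration is a continuous map having the homotopy lifting property with respect to all $n$-spheres (equivalently, all CW-complexes); a Hurewicz fibration is a continuous map having the homotopy lifting property with respect to arbitrary topological spaces. *)

theory Defs
  imports "HOL-Probability.Probability" "HOL-Homology.Homology"
begin

section \<open>Nonatomic standard probability spaces\<close>

definition iso_mod_null :: "'a measure \<Rightarrow> 'b measure \<Rightarrow> bool" where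
  "iso_mod_null M N \<longleftrightarrow>
    (\<exists>A\<in>sets M. \<exists>B\<in>sets N. \<exists>\<phi>.
       space M - A \<in> null_sets M \<and> space N - B \<in> null_sets N \<and>
       bij_betw \<phi> A B \<and>
       \<phi> \<in> restrict_space M A \<rightarrow>\<^sub>M restrict_space N B \<and>
       the_inv_into A \<phi> \<in> restrict_space N B \<rightarrow>\<^sub>M restrict_space M A \<and>
       distr (restrict_space M A) (restrict_space N B) \<phi> = restrict_space N B)"

text \<open>The completion makes the notion independent of whether the measure space itself is
  complete: both the Borel and the Lebesgue measure on the unit interval qualify.\<close>

definition nonatomic_standard_prob_space :: "'w measure \<Rightarrow> bool" where
  "nonatomic_standard_prob_space M \<longleftrightarrow>
     prob_space M \<and> iso_mod_null (completion M) (lebesgue_on {0..1::real})"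


section \<open>Measurable maps into a discrete set, modulo almost everywhere equality\<close>

definition ae_rel :: "'w measure \<Rightarrow> 's set \<Rightarrow> (('w \<Rightarrow> 's) \<times> ('w \<Rightarrow> 's)) set" where
  "ae_rel M S = {(f, g). f \<in> M \<rightarrow>\<^sub>M count_space S \<and> g \<in> M \<rightarrow>\<^sub>M count_space S \<and>
                         (AE t in M. f t = g t)}"

definition L_space :: "'w measure \<Rightarrow> 's set \<Rightarrow> ('w \<Rightarrow> 's) set set" where
  "L_space M S = (M \<rightarrow>\<^sub>M count_space S) // ae_rel M S"

text \<open>Notions on classes are defined through an arbitrary representative; the lemmas below show
  that the choice is immaterial.\<close>

definition ae_rep :: "('w \<Rightarrow> 's) set \<Rightarrow> 'w \<Rightarrow> 's" where
  "ae_rep F = (SOME f. f \<in> F)"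

text \<open>When \<open>S\<close> is uncountable, the set where two measurable maps differ need not belong to the
  original sigma-algebra, hence the completion.\<close>

definition L_dist :: "'w measure \<Rightarrow> ('w \<Rightarrow> 's) set \<Rightarrow> ('w \<Rightarrow> 's) set \<Rightarrow> real" where
  "L_dist M F G = measure (completion M) {t \<in> space M. ae_rep F t \<noteq> ae_rep G t}"

definition L_topology :: "'w measure \<Rightarrow> 's set \<Rightarrow> ('w \<Rightarrow> 's) set topology" where
  "L_topology M S = Metric_space.mtopology (L_space M S) (L_dist M)"

definition law :: "'w measure \<Rightarrow> 's set \<Rightarrow> ('w \<Rightarrow> 's) set \<Rightarrow> 's \<Rightarrow> real" where
  "law M S F = (\<lambda>s\<in>S. measure M (ae_rep F -` {s} \<inter> space M))"

definition ess_image :: "'w measure \<Rightarrow> 's set \<Rightarrow> ('w \<Rightarrow> 's) set \<Rightarrow> 's set" where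
  "ess_image M S F = {s \<in> S. measure M (ae_rep F -` {s} \<inter> space M) > 0}"

lemma equiv_ae_rel: "equiv (M \<rightarrow>\<^sub>M count_space S) (ae_rel M S)"
proof (rule equivI)
  show "ae_rel M S \<subseteq> (M \<rightarrow>\<^sub>M count_space S) \<times> (M \<rightarrow>\<^sub>M count_space S)"
    by (auto simp: ae_rel_def)
  show "refl_on (M \<rightarrow>\<^sub>M count_space S) (ae_rel M S)"
    by (auto simp: ae_rel_def refl_on_def)
  show "sym (ae_rel M S)"
    by (auto simp: ae_rel_def sym_def eq_commute)
  show "trans (ae_rel M S)"
  proof (rule transI)
    fix f g h assume "(f, g) \<in> ae_rel M S" "(g, h) \<in> ae_rel M S"
    then show "(f, h) \<in> ae_rel M S" by (auto simp: ae_rel_def)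
  qed
qed

lemma ae_rep_rel:
  assumes "F \<in> L_space M S" "f \<in> F"
  shows "(ae_rep F, f) \<in> ae_rel M S"
proof -
  have "ae_rep F \<in> F" unfolding ae_rep_def using assms(2) by (metis someI)
  with assms show ?thesis
    unfolding L_space_def by (meson quotient_eq_iff[OF equiv_ae_rel] quotient_eqI[OF equiv_ae_rel])
qed

lemma law_eq:
  assumes "F \<in> L_space M S" "f \<in> F"
  shows "law M S F = (\<lambda>s\<in>S. measure M (f -` {s} \<inter> space M))"
proof -
  note * = ae_rep_rel[OF assms, unfolded ae_rel_def, simplified]
  have "measure M (ae_rep F -` {s} \<inter> space M) = measure M (f -` {s} \<inter> space M)" if "s \<in> S" for s
  proof (rule measure_eq_AE)
    show "AE x in M. (x \<in> ae_rep F -` {s} \<inter> space M) = (x \<in> f -` {s} \<inter> space M)"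
      using * by auto
    show "ae_rep F -` {s} \<inter> space M \<in> sets M" "f -` {s} \<inter> space M \<in> sets M"
      using * that by (auto intro!: measurable_sets[where A = "count_space S"])
  qed
  then show ?thesis by (auto simp: law_def restrict_def fun_eq_iff)
qed

lemma ess_image_eq:
  assumes "F \<in> L_space M S" "f \<in> F"
  shows "ess_image M S F = {s \<in> S. measure M (f -` {s} \<inter> space M) > 0}"
proof -
  have "ess_image M S F = {s \<in> S. law M S F s > 0}"
    by (auto simp: ess_image_def law_def)
  then show ?thesis by (auto simp: law_eq[OF assms])
qed

lemma L_dist_eq:
  assumes "F \<in> L_space M S" "f \<in> F" "G \<in> L_space M S" "g \<in> G"
  shows "L_dist M F G = measure (completion M) {t \<in> space M. f t \<noteq> g t}"
proof -
  let ?A = "{t \<in> space M. ae_rep F t \<noteq> ae_rep G t}" and ?B = "{t \<in> space M. f t \<noteq> g t}"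
  have "AE t in M. ae_rep F t = f t" "AE t in M. ae_rep G t = g t"
    using ae_rep_rel assms by (fastforce simp: ae_rel_def)+
  then have AE: "AE t in completion M. t \<in> ?A \<longleftrightarrow> t \<in> ?B"
    by (intro AE_completion) auto
  have "?A \<in> sets (completion M) \<longleftrightarrow> ?B \<in> sets (completion M)"
  proof -
    from AE obtain N where N: "N \<in> null_sets (completion M)"
        "{t \<in> space (completion M). \<not> (t \<in> ?A \<longleftrightarrow> t \<in> ?B)} \<subseteq> N"
      unfolding eventually_ae_filter by blast
    have null: "X \<in> sets (completion M)" if "X \<subseteq> N" for X
      using N(1) that by (meson completion.complete2 null_setsD2)
    have "?A - ?B \<subseteq> N" "?B - ?A \<subseteq> N" using N(2) by auto
    then have d: "?A - ?B \<in> sets (completion M)" "?B - ?A \<in> sets (completion M)" by (simp_all only: null)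
    have imp: "Y \<in> sets (completion M)"
      if "X \<in> sets (completion M)" "X - Y \<in> sets (completion M)" "Y - X \<in> sets (completion M)" for X Y
    proof -
      have "Y = (X - (X - Y)) \<union> (Y - X)" by blast
      then show ?thesis using that sets.Diff sets.Un by metis
    qed
    show ?thesis using imp[OF _ d] imp[OF _ d(2,1)] by (rule iffI)
  qed
  then consider "?A \<in> sets (completion M)" "?B \<in> sets (completion M)"
    | "?A \<notin> sets (completion M)" "?B \<notin> sets (completion M)" by blast
  then have "measure (completion M) ?A = measure (completion M) ?B"
  proof cases
    case 1
    with AE show ?thesis by (rule measure_eq_AE)
  next
    case 2
    show ?thesis unfolding measure_notin_sets[OF 2(1)] measure_notin_sets[OF 2(2)] ..
  qed
  then show ?thesis unfolding L_dist_def .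
qed


section \<open>Simplicial complexes and their realizations\<close>

definition abstract_simplicial_complex :: "'s set \<Rightarrow> 's set set \<Rightarrow> bool" where
  "abstract_simplicial_complex S K \<longleftrightarrow>
     (\<forall>\<sigma>\<in>K. \<sigma> \<noteq> {} \<and> finite \<sigma> \<and> \<sigma> \<subseteq> S) \<and>
     (\<forall>\<sigma>\<in>K. \<forall>\<tau>. \<tau> \<noteq> {} \<and> \<tau> \<subseteq> \<sigma> \<longrightarrow> \<tau> \<in> K)"

definition L_cplx :: "'w measure \<Rightarrow> 's set \<Rightarrow> 's set set \<Rightarrow> ('w \<Rightarrow> 's) set topology" where
  "L_cplx M S K = subtopology (L_topology M S) {F \<in> L_space M S. ess_image M S F \<in> K}"

definition L_cplx_closure :: "'w measure \<Rightarrow> 's set \<Rightarrow> 's set set \<Rightarrow> ('w \<Rightarrow> 's) set topology" where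
  "L_cplx_closure M S K =
     subtopology (L_topology M S) (L_topology M S closure_of {F \<in> L_space M S. ess_image M S F \<in> K})"

definition l1_dist :: "'s set \<Rightarrow> ('s \<Rightarrow> real) \<Rightarrow> ('s \<Rightarrow> real) \<Rightarrow> real" where
  "l1_dist S \<alpha> \<beta> = (\<Sum>\<^sub>\<infinity>s\<in>S. \<bar>\<alpha> s - \<beta> s\<bar>)"

definition realization_set :: "'s set \<Rightarrow> 's set set \<Rightarrow> ('s \<Rightarrow> real) set" where
  "realization_set S K =
     {\<alpha> \<in> S \<rightarrow>\<^sub>E {0..1}. {s \<in> S. \<alpha> s > 0} \<in> K \<and> (\<alpha> has_sum 1) S}"

definition realization :: "'s set \<Rightarrow> 's set set \<Rightarrow> ('s \<Rightarrow> real) topology" where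
  "realization S K = Metric_space.mtopology (realization_set S K) (l1_dist S)"

text \<open>The metric completion of the realization, in its concrete description; it is complete and
  contains the realization as a dense subset, see below.\<close>

definition realization_completion_set :: "'s set \<Rightarrow> 's set set \<Rightarrow> ('s \<Rightarrow> real) set" where
  "realization_completion_set S K =
     {\<alpha> \<in> S \<rightarrow>\<^sub>E {0..1}. (\<alpha> has_sum 1) S \<and>
        (\<forall>\<tau>. \<tau> \<noteq> {} \<and> finite \<tau> \<and> \<tau> \<subseteq> {s \<in> S. \<alpha> s \<noteq> 0} \<longrightarrow> \<tau> \<in> K)}"

definition realization_completion :: "'s set \<Rightarrow> 's set set \<Rightarrow> ('s \<Rightarrow> real) topology" where
  "realization_completion S K =
     Metric_space.mtopology (realization_completion_set S K) (l1_dist S)"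


lemma l1_summable:
  assumes "(\<alpha> has_sum a) S" "(\<beta> has_sum b) S" "\<And>s. s \<in> S \<Longrightarrow> 0 \<le> \<alpha> s" "\<And>s. s \<in> S \<Longrightarrow> 0 \<le> \<beta> s"
  shows "(\<lambda>s. \<bar>\<alpha> s - \<beta> s :: real\<bar>) summable_on S"
proof (rule summable_on_comparison_test)
  show "(\<lambda>s. \<alpha> s + \<beta> s) summable_on S"
    using assms(1,2) by (intro summable_on_add) (auto simp: summable_on_def)
  show "\<bar>\<alpha> s - \<beta> s\<bar> \<le> \<alpha> s + \<beta> s" if "s \<in> S" for s
    using assms(3,4)[OF that] by linarith
qed auto

lemma Metric_space_realization_completion:
  "Metric_space (realization_completion_set S K) (l1_dist S)"
proof
  fix \<alpha> \<beta> :: "'a \<Rightarrow> real"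
  show "0 \<le> l1_dist S \<alpha> \<beta>" unfolding l1_dist_def by (rule infsum_nonneg) auto
  show "l1_dist S \<alpha> \<beta> = l1_dist S \<beta> \<alpha>" unfolding l1_dist_def by (simp add: abs_minus_commute)
next
  fix \<alpha> \<beta>
  assume *: "\<alpha> \<in> realization_completion_set S K" "\<beta> \<in> realization_completion_set S K"
  then have sm: "(\<lambda>s. \<bar>\<alpha> s - \<beta> s\<bar>) summable_on S"
    by (intro l1_summable) (auto simp: realization_completion_set_def PiE_iff)
  show "l1_dist S \<alpha> \<beta> = 0 \<longleftrightarrow> \<alpha> = \<beta>"
  proof
    assume "l1_dist S \<alpha> \<beta> = 0"
    then have "\<bar>\<alpha> s - \<beta> s\<bar> = 0" if "s \<in> S" for s
      using nonneg_infsum_le_0D[OF _ sm _ that] by (auto simp: l1_dist_def)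
    then show "\<alpha> = \<beta>"
      using * by (intro PiE_ext[of \<alpha> S "\<lambda>_. {0..1}" \<beta>]) (auto simp: realization_completion_set_def)
  qed (simp add: l1_dist_def)
  fix \<gamma> assume "\<gamma> \<in> realization_completion_set S K"
  with * have sm': "(\<lambda>s. \<bar>\<beta> s - \<gamma> s\<bar>) summable_on S" "(\<lambda>s. \<bar>\<alpha> s - \<gamma> s\<bar>) summable_on S"
    by (auto intro!: l1_summable simp: realization_completion_set_def PiE_iff)
  have "l1_dist S \<alpha> \<gamma> \<le> (\<Sum>\<^sub>\<infinity>s\<in>S. \<bar>\<alpha> s - \<beta> s\<bar> + \<bar>\<beta> s - \<gamma> s\<bar>)"
    unfolding l1_dist_def by (rule infsum_mono) (auto intro: summable_on_add sm sm')
  also have "\<dots> = l1_dist S \<alpha> \<beta> + l1_dist S \<beta> \<gamma>"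
    unfolding l1_dist_def by (rule infsum_add[OF sm sm'(1)])
  finally show "l1_dist S \<alpha> \<gamma> \<le> l1_dist S \<alpha> \<beta> + l1_dist S \<beta> \<gamma>" .
qed

lemma realization_set_subset:
  assumes "abstract_simplicial_complex S K"
  shows "realization_set S K \<subseteq> realization_completion_set S K"
proof
  fix \<alpha> assume *: "\<alpha> \<in> realization_set S K"
  have "0 \<le> \<alpha> s" if "s \<in> S" for s
    using * that unfolding realization_set_def PiE_iff by simp
  then have "{s \<in> S. \<alpha> s \<noteq> 0} = {s \<in> S. \<alpha> s > 0}"
    by (metis (no_types, lifting) order_less_le)
  moreover have "{s \<in> S. \<alpha> s > 0} \<in> K"
    using * unfolding realization_set_def by blast
  ultimately have "\<forall>\<tau>. \<tau> \<noteq> {} \<and> finite \<tau> \<and> \<tau> \<subseteq> {s \<in> S. \<alpha> s \<noteq> 0} \<longrightarrow> \<tau> \<in> K"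
    using assms unfolding abstract_simplicial_complex_def by metis
  with * show "\<alpha> \<in> realization_completion_set S K"
    unfolding realization_set_def realization_completion_set_def by blast
qed

lemma mcomplete_realization_completion:
  "Metric_space.mcomplete (realization_completion_set S K) (l1_dist S)"
proof -
  let ?X = "realization_completion_set S K"
  interpret Metric_space ?X "l1_dist S" by (rule Metric_space_realization_completion)
  have "\<exists>a. limitin mtopology \<sigma> a sequentially" if C: "MCauchy \<sigma>" for \<sigma>
  proof -
    have X: "\<sigma> n \<in> ?X" for n using C by (auto simp: MCauchy_def)
    have ns: "0 \<le> \<sigma> n s" "\<sigma> n s \<le> 1" if "s \<in> S" for n s
      using X[of n] that by (auto simp: realization_completion_set_def PiE_iff)
    have hs: "(\<sigma> n has_sum 1) S" for n using X by (auto simp: realization_completion_set_def)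
    have sm: "(\<lambda>s. \<bar>\<sigma> n s - \<sigma> m s\<bar>) summable_on S" for n m
      by (rule l1_summable[OF hs hs]) (auto simp: ns)
    have fin: "(\<Sum>s\<in>T. \<bar>\<sigma> n s - \<sigma> m s\<bar>) \<le> l1_dist S (\<sigma> n) (\<sigma> m)" if "finite T" "T \<subseteq> S" for T n m
      unfolding l1_dist_def using that by (intro finite_sum_le_infsum sm) auto
    have "Cauchy (\<lambda>n. \<sigma> n s)" if "s \<in> S" for s
    proof (rule CauchyI)
      fix e :: real assume "e > 0"
      then obtain N where N: "\<forall>n n'. N \<le> n \<longrightarrow> N \<le> n' \<longrightarrow> l1_dist S (\<sigma> n) (\<sigma> n') < e"
        using C unfolding MCauchy_def by blast
      have "norm (\<sigma> m s - \<sigma> n s) < e" if "m \<ge> N" "n \<ge> N" for m n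
        using fin[of "{s}" m n] \<open>s \<in> S\<close> N[rule_format, OF that] by simp
      then show "\<exists>M. \<forall>m\<ge>M. \<forall>n\<ge>M. norm (\<sigma> m s - \<sigma> n s) < e"
        by blast
    qed
    then have "\<forall>s. \<exists>l. s \<in> S \<longrightarrow> (\<lambda>n. \<sigma> n s) \<longlonglongrightarrow> l"
      by (metis Cauchy_convergent convergent_def)
    then obtain a0 where a0: "\<And>s. s \<in> S \<Longrightarrow> (\<lambda>n. \<sigma> n s) \<longlonglongrightarrow> a0 s" by metis
    define a where "a = restrict a0 S"
    have a: "(\<lambda>n. \<sigma> n s) \<longlonglongrightarrow> a s" if "s \<in> S" for s using a0 that by (simp add: a_def)
    have aPi: "a \<in> S \<rightarrow>\<^sub>E {0..1}"
    proof -
      have "0 \<le> a s \<and> a s \<le> 1" if "s \<in> S" for s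
        using LIMSEQ_le_const[OF a[OF that]] LIMSEQ_le_const2[OF a[OF that]] ns[OF that] by blast
      then show ?thesis by (simp add: PiE_iff) (simp add: a_def)
    qed
    have key: "\<exists>N. \<forall>n\<ge>N. (\<lambda>s. \<bar>\<sigma> n s - a s\<bar>) summable_on S \<and> l1_dist S (\<sigma> n) a \<le> e"
      if "e > 0" for e
    proof -
      obtain N where N: "\<And>n n'. N \<le> n \<Longrightarrow> N \<le> n' \<Longrightarrow> l1_dist S (\<sigma> n) (\<sigma> n') < e"
        using C \<open>e > 0\<close> unfolding MCauchy_def by blast
      have "(\<lambda>s. \<bar>\<sigma> n s - a s\<bar>) summable_on S \<and> l1_dist S (\<sigma> n) a \<le> e" if "n \<ge> N" for n
      proof -
        have le: "(\<Sum>s\<in>T. \<bar>\<sigma> n s - a s\<bar>) \<le> e" if T: "finite T" "T \<subseteq> S" for T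
        proof (rule LIMSEQ_le_const2)
          show "(\<lambda>m. \<Sum>s\<in>T. \<bar>\<sigma> n s - \<sigma> m s\<bar>) \<longlonglongrightarrow> (\<Sum>s\<in>T. \<bar>\<sigma> n s - a s\<bar>)"
            using T by (intro tendsto_intros a) auto
          show "\<exists>M. \<forall>m\<ge>M. (\<Sum>s\<in>T. \<bar>\<sigma> n s - \<sigma> m s\<bar>) \<le> e"
            using fin[OF T] N \<open>n \<ge> N\<close> by (meson less_imp_le order_trans)
        qed
        have "(\<lambda>s. \<bar>\<sigma> n s - a s\<bar>) summable_on S"
          by (rule nonneg_bdd_above_summable_on) (use le in \<open>auto simp: bdd_above_def\<close>)
        with le show ?thesis unfolding l1_dist_def by (auto intro: infsum_le_finite_sums)
      qed
      then show ?thesis by blast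
    qed
    have hsum: "(a has_sum 1) S"
    proof -
      obtain n where "(\<lambda>s. \<bar>\<sigma> n s - a s\<bar>) summable_on S" using key[of 1] by auto
      then have "(\<lambda>s. \<sigma> n s - a s) summable_on S"
        by (subst (asm) real_norm_def[symmetric]) (rule abs_summable_summable)
      moreover have "\<sigma> n summable_on S" using hs by (auto simp: summable_on_def)
      ultimately have "(\<lambda>s. \<sigma> n s + - (\<sigma> n s - a s)) summable_on S"
        by (intro summable_on_add summable_on_uminus[THEN iffD2])
      then have as: "a summable_on S" by simp
      have "\<bar>infsum a S - 1\<bar> \<le> e" if "e > 0" for e
      proof -
        obtain n where n: "(\<lambda>s. \<bar>\<sigma> n s - a s\<bar>) summable_on S" "l1_dist S (\<sigma> n) a \<le> e"
          using key[OF \<open>e > 0\<close>] by auto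
        have "((\<lambda>s. \<sigma> n s + - a s) has_sum (1 + - infsum a S)) S"
          by (intro has_sum_add hs has_sum_uminusI has_sum_infsum as)
        then have "1 - infsum a S = (\<Sum>\<^sub>\<infinity>s\<in>S. \<sigma> n s - a s)"
          by (simp add: infsumI)
        also have "\<bar>\<dots>\<bar> \<le> (\<Sum>\<^sub>\<infinity>s\<in>S. \<bar>\<sigma> n s - a s\<bar>)"
          using norm_infsum_bound[of "\<lambda>s. \<sigma> n s - a s" S] n(1) by simp
        finally show ?thesis using n(2) by (simp add: l1_dist_def abs_minus_commute)
      qed
      then have "\<bar>infsum a S - 1\<bar> \<le> 0" by (rule field_le_epsilon) simp
      then show ?thesis using has_sum_infsum[OF as] by simp
    qed
    have "\<tau> \<in> K" if \<tau>: "\<tau> \<noteq> {}" "finite \<tau>" "\<tau> \<subseteq> {s \<in> S. a s \<noteq> 0}" for \<tau>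
    proof -
      have "\<forall>\<^sub>F n in sequentially. \<sigma> n s \<noteq> 0" if "s \<in> \<tau>" for s
        by (rule tendsto_imp_eventually_ne[OF a[of s]]) (use \<tau>(3) that in auto)
      then have "\<forall>\<^sub>F n in sequentially. \<forall>s\<in>\<tau>. \<sigma> n s \<noteq> 0"
        using \<tau>(2) by (simp add: eventually_ball_finite)
      then obtain n where "\<forall>s\<in>\<tau>. \<sigma> n s \<noteq> 0" by (auto simp: eventually_sequentially)
      with X[of n] \<tau> show ?thesis by (auto simp: realization_completion_set_def)
    qed
    with aPi hsum have aX: "a \<in> ?X" by (auto simp: realization_completion_set_def)
    have "limitin mtopology \<sigma> a sequentially"
      unfolding limit_metric_sequentially
    proof (intro conjI aX allI impI)
      fix e :: real assume "e > 0"
      then obtain N where "\<forall>n\<ge>N. l1_dist S (\<sigma> n) a \<le> e/2" using key[of "e/2"] by auto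
      with \<open>e > 0\<close> X show "\<exists>N. \<forall>n\<ge>N. \<sigma> n \<in> ?X \<and> l1_dist S (\<sigma> n) a < e"
        by (intro exI[of _ N]) force
    qed
    then show ?thesis by blast
  qed
  then show ?thesis by (auto simp: mcomplete_def)
qed

lemma realization_dense:
  assumes "abstract_simplicial_complex S K"
  shows "realization_completion S K closure_of realization_set S K = realization_completion_set S K"
proof -
  let ?X = "realization_completion_set S K"
  interpret Metric_space ?X "l1_dist S" by (rule Metric_space_realization_completion)
  have "\<exists>\<beta>\<in>realization_set S K. \<beta> \<in> mball \<alpha> e" if \<alpha>: "\<alpha> \<in> ?X" and "e > 0" for \<alpha> e
  proof -
    have hs: "(\<alpha> has_sum 1) S" and ns: "\<And>s. s \<in> S \<Longrightarrow> 0 \<le> \<alpha> s" "\<And>s. s \<in> S \<Longrightarrow> \<alpha> s \<le> 1"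
      using \<alpha> by (auto simp: realization_completion_set_def PiE_iff)
    define d where "d = min (e/4) (1/2)"
    have d: "d > 0" "d \<le> 1/2" "2 * d < e" using \<open>e > 0\<close> by (auto simp: d_def min_def)
    obtain T where T: "finite T" "T \<subseteq> S" "dist (sum \<alpha> T) 1 \<le> d"
      using has_sum_finite_approximation[OF hs \<open>d > 0\<close>] by blast
    define c where "c = sum \<alpha> T"
    have c: "c > 0" "1 - c \<le> d" using T(3) d by (auto simp: c_def dist_real_def)
    have c1: "c \<le> 1"
      unfolding c_def by (rule finite_sum_le_has_sum[OF hs]) (use T ns in auto)
    define \<beta> where "\<beta> = (\<lambda>s\<in>S. if s \<in> T then \<alpha> s / c else 0)"
    have le: "\<alpha> s \<le> c" if "s \<in> T" for s
      unfolding c_def using T ns that by (intro member_le_sum) auto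
    have "(\<beta> has_sum (\<Sum>s\<in>T. \<alpha> s / c)) S"
      by (rule has_sum_finite_neutralI) (use T in \<open>auto simp: \<beta>_def intro!: sum.cong\<close>)
    then have \<beta>1: "(\<beta> has_sum 1) S" using c by (simp flip: sum_divide_distrib c_def)
    have sup: "{s \<in> S. \<beta> s > 0} = {s \<in> T. \<alpha> s \<noteq> 0}"
      using T ns c by (force simp: \<beta>_def zero_less_divide_iff order_less_le)
    have "{s \<in> T. \<alpha> s \<noteq> 0} \<noteq> {}"
    proof
      assume "{s \<in> T. \<alpha> s \<noteq> 0} = {}"
      then have "c = 0" unfolding c_def by (intro sum.neutral) auto
      with c show False by simp
    qed
    moreover have "{s \<in> T. \<alpha> s \<noteq> 0} \<subseteq> {s \<in> S. \<alpha> s \<noteq> 0}" using T by auto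
    ultimately have "{s \<in> S. \<beta> s > 0} \<in> K"
      unfolding sup using \<alpha> T(1) by (auto simp: realization_completion_set_def)
    then have \<beta>: "\<beta> \<in> realization_set S K"
      using \<beta>1 T ns c le by (auto simp: realization_set_def \<beta>_def divide_le_eq)
    have "l1_dist S \<alpha> \<beta> = 2 * (1 - c)"
    proof -
      have "((\<lambda>s. \<alpha> s * (if s \<in> T then 1 else 0)) has_sum c) S"
        unfolding c_def by (rule has_sum_finite_neutralI) (use T in \<open>auto intro!: sum.cong\<close>)
      then have "((\<lambda>s. - (\<alpha> s * (if s \<in> T then 1 else 0))) has_sum (- c)) S"
        by (rule has_sum_uminusI)
      from has_sum_add[OF hs this]
      have 1: "((\<lambda>s. \<alpha> s - \<alpha> s * (if s \<in> T then 1 else 0)) has_sum (1 - c)) S" by simp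
      have "((\<lambda>s. if s \<in> T then \<alpha> s / c - \<alpha> s else 0) has_sum (\<Sum>s\<in>T. \<alpha> s / c - \<alpha> s)) S"
        by (rule has_sum_finite_neutralI) (use T in \<open>auto intro!: sum.cong\<close>)
      moreover have "(\<Sum>s\<in>T. \<alpha> s / c - \<alpha> s) = 1 - c"
        using c by (simp add: sum_subtractf flip: sum_divide_distrib c_def)
      ultimately have 2: "((\<lambda>s. if s \<in> T then \<alpha> s / c - \<alpha> s else 0) has_sum (1 - c)) S" by simp
      have "\<bar>\<alpha> s - \<beta> s\<bar> = (\<alpha> s - \<alpha> s * (if s \<in> T then 1 else 0)) + (if s \<in> T then \<alpha> s / c - \<alpha> s else 0)"
        if "s \<in> S" for s
      proof -
        have "\<alpha> s \<le> \<alpha> s / c"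
          using ns[OF that] c c1 by (simp add: le_divide_eq mult_left_le)
        then show ?thesis using that ns[OF that] by (auto simp: \<beta>_def)
      qed
      then have "((\<lambda>s. \<bar>\<alpha> s - \<beta> s\<bar>) has_sum ((1 - c) + (1 - c))) S"
        using has_sum_add[OF 1 2] by (simp cong: has_sum_cong)
      then show ?thesis unfolding l1_dist_def by (simp add: infsumI)
    qed
    also have "\<dots> \<le> 2 * d" using c(2) by simp
    also note d(3)
    finally have "l1_dist S \<alpha> \<beta> < e" .
    then show ?thesis
      using \<beta> \<alpha> realization_set_subset[OF assms] by (intro bexI[of _ \<beta>]) auto
  qed
  then show ?thesis
    unfolding realization_completion_def metric_closure_of by blast
qed


section \<open>Fibrations\<close>

definition homotopy_lifting ::
  "'z topology \<Rightarrow> 'a topology \<Rightarrow> 'b topology \<Rightarrow> ('a \<Rightarrow> 'b) \<Rightarrow> bool" where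
  "homotopy_lifting Z X Y p \<longleftrightarrow>
     (\<forall>f h. continuous_map Z X f \<and>
            continuous_map (prod_topology (top_of_set {0..1::real}) Z) Y h \<and>
            (\<forall>z\<in>topspace Z. h (0, z) = p (f z)) \<longrightarrow>
        (\<exists>H. continuous_map (prod_topology (top_of_set {0..1::real}) Z) X H \<and>
             (\<forall>z\<in>topspace Z. H (0, z) = f z) \<and>
             (\<forall>t\<in>{0..1}. \<forall>z\<in>topspace Z. p (H (t, z)) = h (t, z))))"

definition serre_fibration :: "'a topology \<Rightarrow> 'b topology \<Rightarrow> ('a \<Rightarrow> 'b) \<Rightarrow> bool" where
  "serre_fibration X Y p \<longleftrightarrow>
     continuous_map X Y p \<and> (\<forall>n. homotopy_lifting (nsphere n) X Y p)"

text \<open>HOL cannot quantify over types inside a definition. The test spaces range over all topologies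
  on subsets of the type \<open>'z\<close>; a theorem that keeps \<open>'z\<close> as a type variable of its own thus covers
  arbitrary topological spaces.\<close>

definition hurewicz_fibration ::
  "'z itself \<Rightarrow> 'a topology \<Rightarrow> 'b topology \<Rightarrow> ('a \<Rightarrow> 'b) \<Rightarrow> bool" where
  "hurewicz_fibration _ X Y p \<longleftrightarrow>
     continuous_map X Y p \<and> (\<forall>Z :: 'z topology. homotopy_lifting Z X Y p)"


section \<open>Homotopy equivalences and weak homotopy equivalences\<close>

definition homotopy_equivalence :: "'a topology \<Rightarrow> 'b topology \<Rightarrow> ('a \<Rightarrow> 'b) \<Rightarrow> bool" where
  "homotopy_equivalence X Y p \<longleftrightarrow>
     continuous_map X Y p \<and>
     (\<exists>q. continuous_map Y X q \<and>
          homotopic_with (\<lambda>_. True) X X (q \<circ> p) id \<and>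
          homotopic_with (\<lambda>_. True) Y Y (p \<circ> q) id)"

definition cube :: "nat \<Rightarrow> (nat \<Rightarrow> real) topology" where
  "cube n = product_topology (\<lambda>_. top_of_set {0..1}) {..<n}"

definition cube_boundary :: "nat \<Rightarrow> (nat \<Rightarrow> real) set" where
  "cube_boundary n = {u \<in> topspace (cube n). \<exists>i<n. u i = 0 \<or> u i = 1}"

definition spheroids :: "nat \<Rightarrow> 'a topology \<Rightarrow> 'a \<Rightarrow> ((nat \<Rightarrow> real) \<Rightarrow> 'a) set" where
  "spheroids n X x = {f. continuous_map (cube n) X f \<and> (\<forall>u\<in>cube_boundary n. f u = x)}"

definition spheroid_class ::
  "nat \<Rightarrow> 'a topology \<Rightarrow> 'a \<Rightarrow> ((nat \<Rightarrow> real) \<Rightarrow> 'a) \<Rightarrow> ((nat \<Rightarrow> real) \<Rightarrow> 'a) set" where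
  "spheroid_class n X x f =
     {g. homotopic_with (\<lambda>k. \<forall>u\<in>cube_boundary n. k u = x) (cube n) X f g}"

definition spheroid_concat ::
  "((nat \<Rightarrow> real) \<Rightarrow> 'a) \<Rightarrow> ((nat \<Rightarrow> real) \<Rightarrow> 'a) \<Rightarrow> (nat \<Rightarrow> real) \<Rightarrow> 'a" where
  "spheroid_concat f g u =
     (if u 0 \<le> 1/2 then f (u(0 := 2 * u 0)) else g (u(0 := 2 * u 0 - 1)))"

text \<open>Meaningful as a group for \<open>n \<ge> 1\<close> only. The product of two classes is the class of the
  concatenation of any two representatives, written as a union so as not to choose them.\<close>

definition homotopy_group ::
  "nat \<Rightarrow> 'a topology \<Rightarrow> 'a \<Rightarrow> ((nat \<Rightarrow> real) \<Rightarrow> 'a) set monoid" where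
  "homotopy_group n X x =
     \<lparr>carrier = spheroid_class n X x ` spheroids n X x,
      monoid.mult = (\<lambda>F G. \<Union>f\<in>F. \<Union>g\<in>G. spheroid_class n X x (spheroid_concat f g)),
      one = spheroid_class n X x (\<lambda>_. x)\<rparr>"

definition homotopy_group_induced ::
  "nat \<Rightarrow> 'b topology \<Rightarrow> 'b \<Rightarrow> ('a \<Rightarrow> 'b) \<Rightarrow> ((nat \<Rightarrow> real) \<Rightarrow> 'a) set \<Rightarrow> ((nat \<Rightarrow> real) \<Rightarrow> 'b) set"
  where
  "homotopy_group_induced n Y y p F = (\<Union>f\<in>F. spheroid_class n Y y (p \<circ> f))"

definition path_components_induced :: "'b topology \<Rightarrow> ('a \<Rightarrow> 'b) \<Rightarrow> 'a set \<Rightarrow> 'b set" where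
  "path_components_induced Y p C = (\<Union>x\<in>C. path_component_of_set Y (p x))"

definition weak_homotopy_equivalence :: "'a topology \<Rightarrow> 'b topology \<Rightarrow> ('a \<Rightarrow> 'b) \<Rightarrow> bool" where
  "weak_homotopy_equivalence X Y p \<longleftrightarrow>
     continuous_map X Y p \<and>
     bij_betw (path_components_induced Y p) (path_components_of X) (path_components_of Y) \<and>
     (\<forall>n\<ge>1. \<forall>x\<in>topspace X.
        homotopy_group_induced n Y (p x) p \<in> iso (homotopy_group n X x) (homotopy_group n Y (p x)))"

end

theory Submission
  imports Defs
begin

text \<open>Everything rests on a continuous \<open>move F \<beta>\<close>, defined for a class \<open>F\<close> of maps and an arbitrary
  probability vector \<open>\<beta>\<close> on \<open>S\<close>, whose law is \<open>\<beta>\<close> and which satisfies \<open>move F (law F) = F\<close>.  It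
  lifts homotopies over any test space, \<open>H (t, z) = move (f z) (h (t, z))\<close>, and \<open>move F\<close> is a section
  of the law map through \<open>F\<close>.  That section is a homotopy inverse relative to \<open>F\<close>: follow \<open>G\<close>
  where a fixed uniform random variable \<open>u\<close> is at most \<open>t\<close> and \<open>move F (law G)\<close> elsewhere.

  To construct \<open>move\<close>, order \<open>S\<close> linearly and order the points \<open>t\<close> of the probability space
  lexicographically by \<open>(f t, u t)\<close>.  The measure \<open>rank f t\<close> of the points below \<open>t\<close> is uniformly
  distributed, and \<open>move\<close> gives \<open>t\<close> the value \<open>s\<close> in whose slot the rank falls, where the slots are
  consecutive intervals of length \<open>\<beta> s\<close>.  Where \<open>f\<close> and \<open>g\<close> agree, their ranks differ by at most
  the distance of \<open>f\<close> and \<open>g\<close>, which gives continuity.\<close>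


section \<open>Homotopy groups and pointed sections\<close>

text \<open>The obstacle is that \<open>S\<close> may be uncountable, with every subset measurable.
  Ranks and slots are handled through maps that take countably many values, each with positive
  probability. That every class contains such a map uses more of the standard structure than a
  uniform variable: label images of null sets must be covered by open sets of small measure. The
  label enters the ranking because the fibres of \<open>f\<close> have positive measure, so that
  \<open>f\<close> alone would produce ties of positive probability; it enters after
  \<open>f\<close> so that the ranks of a fibre fill the very slot which the law of \<open>f\<close>
  assigns to it, whence \<open>move F (law F) = F\<close>. Targets range over all probability
  vectors, without reference to the complex. Both spaces of maps are preimages under the law of a
  set of vectors, and prescribing the law keeps \<open>move\<close> inside them. The homotopy cannot
  prescribe the law; it stays inside because it creates no new values.\<close>

abbreviation unit_interval :: "real topology" where
  "unit_interval \<equiv> top_of_set {0..1}"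

text \<open>A partial equivalence relation: being related to oneself is the same as being a
  spheroid, so one lemma covers both homotopies and membership in \<open>spheroids\<close>.\<close>

definition rel_homotopic ::
  "nat \<Rightarrow> 'a topology \<Rightarrow> 'a \<Rightarrow> ((nat \<Rightarrow> real) \<Rightarrow> 'a) \<Rightarrow> ((nat \<Rightarrow> real) \<Rightarrow> 'a) \<Rightarrow> bool" where
  "rel_homotopic n X x = homotopic_with (\<lambda>k. \<forall>u\<in>cube_boundary n. k u = x) (cube n) X"

lemma spheroid_class_rel: "spheroid_class n X x f = {g. rel_homotopic n X x f g}"
  by (simp add: spheroid_class_def rel_homotopic_def)

lemma spheroids_rel: "f \<in> spheroids n X x \<longleftrightarrow> rel_homotopic n X x f f"
  by (simp add: spheroids_def rel_homotopic_def)

lemma rel_homotopic_sym: "rel_homotopic n X x f g \<Longrightarrow> rel_homotopic n X x g f"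
  unfolding rel_homotopic_def by (rule homotopic_with_symD)

lemma rel_homotopic_trans:
  "rel_homotopic n X x f g \<Longrightarrow> rel_homotopic n X x g h \<Longrightarrow> rel_homotopic n X x f h"
  unfolding rel_homotopic_def by (rule homotopic_with_trans)

lemma spheroid_class_eqI:
  "rel_homotopic n X x f g \<Longrightarrow> spheroid_class n X x f = spheroid_class n X x g"
  unfolding spheroid_class_rel by (blast intro: rel_homotopic_sym rel_homotopic_trans)

lemma spheroid_class_eq_iff:
  assumes "g \<in> spheroids n X x"
  shows "spheroid_class n X x f = spheroid_class n X x g \<longleftrightarrow> rel_homotopic n X x f g"
  using assms spheroid_class_eqI unfolding spheroid_class_rel spheroids_rel by fastforce

lemma rel_homotopic_compose:
  assumes "rel_homotopic n X x f g" "continuous_map X Y p"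
  shows "rel_homotopic n Y (p x) (p \<circ> f) (p \<circ> g)"
  using assms unfolding rel_homotopic_def
  by (rule homotopic_with_compose_continuous_map_left) auto

text \<open>The product and the induced map are defined as unions over representatives. Such a union
  collapses once the value does not depend on the representative and the class is nonempty, as the
  class of a spheroid is.\<close>

lemma UN_spheroid_class_eq:
  assumes "f \<in> spheroids n X x" and "\<And>f'. rel_homotopic n X x f f' \<Longrightarrow> c f' = c f"
  shows "(\<Union>f'\<in>spheroid_class n X x f. c f') = c f"
  using assms unfolding spheroid_class_rel spheroids_rel by blast

lemma homotopy_group_induced_class:
  assumes "f \<in> spheroids n X x" "continuous_map X Y p"
  shows "homotopy_group_induced n Y (p x) p (spheroid_class n X x f) = spheroid_class n Y (p x) (p \<circ> f)"
  unfolding homotopy_group_induced_def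
  by (rule UN_spheroid_class_eq[OF assms(1)])
    (intro spheroid_class_eqI rel_homotopic_compose[OF rel_homotopic_sym assms(2)])

section \<open>Concatenation of spheroids\<close>

lemma topspace_cube: "topspace (cube n) = {..<n} \<rightarrow>\<^sub>E {0..1}"
  by (simp add: cube_def)

lemma cube_coordinate: "u \<in> topspace (cube n) \<Longrightarrow> i < n \<Longrightarrow> 0 \<le> u i \<and> u i \<le> 1"
  by (metis PiE_mem atLeastAtMost_iff lessThan_iff topspace_cube)

text \<open>The affine form serves both halves of a concatenation, with \<open>(a, b)\<close> equal
  to \<open>(2, 0)\<close> and to \<open>(2, -1)\<close>; \<open>Z\<close> is meant to be the half
  of the cylinder on which the rescaled coordinate stays in the unit interval.\<close>

lemma continuous_map_scale_first_coordinate: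
  assumes "n \<ge> 1"
    and Z: "Z \<subseteq> topspace (prod_topology unit_interval (cube n))"
    and ab: "\<And>z. z \<in> Z \<Longrightarrow> a * snd z 0 + b \<in> {0..1}"
    and h: "continuous_map (prod_topology unit_interval (cube n)) X h"
  shows "continuous_map (subtopology (prod_topology unit_interval (cube n)) Z) X
           (\<lambda>z. h (fst z, (snd z)(0 := a * snd z 0 + b)))"
proof -
  let ?P = "prod_topology unit_interval (cube n)"
  have snd_i: "continuous_map (subtopology ?P Z) unit_interval (\<lambda>z. snd z i)" if "i < n" for i
  proof -
    have "continuous_map ?P unit_interval (\<lambda>z. snd z i)"
      using continuous_map_compose[OF continuous_map_snd, of "cube n" unit_interval "\<lambda>u. u i" unit_interval]
        continuous_map_product_projection[of i "{..<n}" "\<lambda>_. unit_interval"] that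
      by (simp add: cube_def o_def)
    then show ?thesis by (rule continuous_map_from_subtopology)
  qed
  have "continuous_map (subtopology ?P Z) ?P (\<lambda>z. (fst z, (snd z)(0 := a * snd z 0 + b)))"
  proof (intro continuous_map_pairedI)
    show "continuous_map (subtopology ?P Z) unit_interval fst"
      by (rule continuous_map_from_subtopology) (rule continuous_map_fst)
    have "continuous_map (subtopology ?P Z) unit_interval (\<lambda>z. ((snd z)(0 := a * snd z 0 + b)) i)"
      if i: "i < n" for i
    proof (cases "i = 0")
      case True
      have "continuous_map (subtopology ?P Z) euclideanreal (\<lambda>z. a * snd z 0 + b)"
        using snd_i[of 0] assms(1) unfolding continuous_map_in_subtopology
        by (auto intro!: continuous_intros)
      moreover have "(\<lambda>z. a * snd z 0 + b) \<in> topspace (subtopology ?P Z) \<rightarrow> {0..1}"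
        using ab by (auto simp del: topspace_prod_topology)
      ultimately show ?thesis using True by (simp add: continuous_map_in_subtopology)
    qed (use snd_i[OF i] in simp)
    moreover have "(snd z)(0 := a * snd z 0 + b) \<in> extensional {..<n}"
      if "z \<in> topspace (subtopology ?P Z)" for z
      using that assms(1) by (auto simp: topspace_cube PiE_def extensional_def)
    ultimately show "continuous_map (subtopology ?P Z) (cube n) (\<lambda>z. (snd z)(0 := a * snd z 0 + b))"
      unfolding cube_def continuous_map_componentwise by (auto simp: cube_def)
  qed
  from continuous_map_compose[OF this h] show ?thesis by (simp add: o_def)
qed

text \<open>The two homotopies can be concatenated at each time because along
  \<open>u 0 = 1/2\<close> both rescaled points lie on the boundary of the cube, where both values
  are \<open>x\<close>. The case \<open>f = f'\<close>, \<open>g = g'\<close> shows that a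
  concatenation of spheroids is a spheroid.\<close>

lemma rel_homotopic_concat:
  assumes n: "n \<ge> 1" and f: "rel_homotopic n X x f f'" and g: "rel_homotopic n X x g g'"
  shows "rel_homotopic n X x (spheroid_concat f g) (spheroid_concat f' g')"
proof -
  let ?P = "prod_topology unit_interval (cube n)"
  obtain h where h: "continuous_map ?P X h" "\<And>u. h (0, u) = f u" "\<And>u. h (1, u) = f' u"
      "\<And>t u. t \<in> {0..1} \<Longrightarrow> u \<in> cube_boundary n \<Longrightarrow> h (t, u) = x"
    using f unfolding rel_homotopic_def homotopic_with_def by blast
  obtain k where k: "continuous_map ?P X k" "\<And>u. k (0, u) = g u" "\<And>u. k (1, u) = g' u"
      "\<And>t u. t \<in> {0..1} \<Longrightarrow> u \<in> cube_boundary n \<Longrightarrow> k (t, u) = x"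
    using g unfolding rel_homotopic_def homotopic_with_def by blast
  define H where "H = (\<lambda>z. if snd z 0 \<le> 1/2 then h (fst z, (snd z)(0 := 2 * snd z 0 + 0))
                       else k (fst z, (snd z)(0 := 2 * snd z 0 + -1)))"
  have H: "H (t, u) = spheroid_concat (\<lambda>u. h (t, u)) (\<lambda>u. k (t, u)) u" for t u
    by (simp add: H_def spheroid_concat_def)
  have upd: "u(0 := c) \<in> cube_boundary n"
    if "u \<in> topspace (cube n)" "c \<in> {0..1}" "c = 0 \<or> c = 1 \<or> (\<exists>i<n. i \<noteq> 0 \<and> (u i = 0 \<or> u i = 1))" for u c
  proof -
    have "u(0 := c) \<in> topspace (cube n)"
      using that(1,2) n by (auto simp: topspace_cube PiE_iff extensional_def)
    moreover have "\<exists>i<n. (u(0 := c)) i = 0 \<or> (u(0 := c)) i = 1"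
      using that(3) n by (metis One_nat_def Suc_le_lessD fun_upd_other fun_upd_same)
    ultimately show ?thesis by (simp add: cube_boundary_def)
  qed
  have "continuous_map ?P X H"
    unfolding H_def
  proof (rule continuous_map_cases_le)
    have "continuous_map ?P euclideanreal (\<lambda>z. snd z 0)"
      using continuous_map_compose[OF continuous_map_snd, of "cube n" unit_interval "\<lambda>u. u 0" unit_interval]
        continuous_map_product_projection[of 0 "{..<n}" "\<lambda>_. unit_interval"] n
      by (simp add: cube_def o_def continuous_map_in_subtopology)
    then show "continuous_map ?P euclideanreal (\<lambda>z. snd z 0)" .
    show "continuous_map ?P euclideanreal (\<lambda>z. 1/2)" by simp
    have I: "0 \<le> snd z 0 \<and> snd z 0 \<le> 1" if "z \<in> topspace ?P" for z
      using that n cube_coordinate[of "snd z" n 0] by (auto simp: mem_Times_iff)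
    show "continuous_map (subtopology ?P {z \<in> topspace ?P. snd z 0 \<le> 1/2}) X
            (\<lambda>z. h (fst z, (snd z)(0 := 2 * snd z 0 + 0)))"
      by (rule continuous_map_scale_first_coordinate[OF n _ _ h(1)]) (use I in force)+
    show "continuous_map (subtopology ?P {z \<in> topspace ?P. 1/2 \<le> snd z 0}) X
            (\<lambda>z. k (fst z, (snd z)(0 := 2 * snd z 0 + -1)))"
      by (rule continuous_map_scale_first_coordinate[OF n _ _ k(1)]) (use I in force)+
    show "h (fst z, (snd z)(0 := 2 * snd z 0 + 0)) = k (fst z, (snd z)(0 := 2 * snd z 0 + -1))"
      if "z \<in> topspace ?P" "snd z 0 = 1/2" for z
    proof -
      have "fst z \<in> {0..1}" and u: "snd z \<in> topspace (cube n)" using that(1) by auto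
      then have "h (fst z, (snd z)(0 := 1)) = x" "k (fst z, (snd z)(0 := 0)) = x"
        by (auto intro!: h(4) k(4) upd)
      then show ?thesis unfolding that(2) by simp
    qed
  qed
  moreover have "H (t, u) = x" if t: "t \<in> {0..1}" and u: "u \<in> cube_boundary n" for t u
  proof -
    have ut: "u \<in> topspace (cube n)" and u0: "0 \<le> u 0" "u 0 \<le> 1"
      using u n cube_coordinate[of u n 0] by (auto simp: cube_boundary_def)
    obtain i where i: "i < n" "u i = 0 \<or> u i = 1" using u unfolding cube_boundary_def by blast
    show ?thesis
    proof (cases "u 0 \<le> 1/2")
      case True
      then have "u(0 := 2 * u 0) \<in> cube_boundary n"
      proof (intro upd[OF ut])
        show "2 * u 0 \<in> {0..1}" using True u0 by simp
        \<comment> \<open>If the boundary coordinate is the first one, it must be 0, since 1 is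
          excluded in this half.\<close>
        show "2 * u 0 = 0 \<or> 2 * u 0 = 1 \<or> (\<exists>i<n. i \<noteq> 0 \<and> (u i = 0 \<or> u i = 1))"
          using i True by (cases "i = 0") auto
      qed
      with True h(4)[OF t] show ?thesis by (simp add: H_def)
    next
      case False
      then have "u(0 := 2 * u 0 - 1) \<in> cube_boundary n"
      proof (intro upd[OF ut])
        show "2 * u 0 - 1 \<in> {0..1}" using False u0 by simp
        show "2 * u 0 - 1 = 0 \<or> 2 * u 0 - 1 = 1 \<or> (\<exists>i<n. i \<noteq> 0 \<and> (u i = 0 \<or> u i = 1))"
          using i False by (cases "i = 0") auto
      qed
      with False k(4)[OF t] show ?thesis by (simp add: H_def)
    qed
  qed
  ultimately show ?thesis
    unfolding rel_homotopic_def homotopic_with_def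
    by (intro exI[of _ H]) (simp add: H h k spheroid_concat_def)
qed

lemma homotopy_group_mult_class:
  assumes "n \<ge> 1" "f \<in> spheroids n X x" "g \<in> spheroids n X x"
  shows "spheroid_class n X x f \<otimes>\<^bsub>homotopy_group n X x\<^esub> spheroid_class n X x g
       = spheroid_class n X x (spheroid_concat f g)"
proof -
  have eq: "spheroid_class n X x (spheroid_concat f' g') = spheroid_class n X x (spheroid_concat f g)"
    if "rel_homotopic n X x f f'" "rel_homotopic n X x g g'" for f' g'
    by (rule spheroid_class_eqI[OF rel_homotopic_sym[OF rel_homotopic_concat[OF assms(1) that]]])
  have f: "rel_homotopic n X x f f" and g: "rel_homotopic n X x g g"
    using assms by (simp_all add: spheroids_rel)
  have inner: "(\<Union>g'\<in>spheroid_class n X x g. spheroid_class n X x (spheroid_concat f' g'))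
      = spheroid_class n X x (spheroid_concat f g)" if f': "rel_homotopic n X x f f'" for f'
  proof -
    have "(\<Union>g'\<in>spheroid_class n X x g. spheroid_class n X x (spheroid_concat f' g'))
        = spheroid_class n X x (spheroid_concat f' g)"
    proof (rule UN_spheroid_class_eq[OF assms(3)])
      fix g' assume "rel_homotopic n X x g g'"
      then show "spheroid_class n X x (spheroid_concat f' g') = spheroid_class n X x (spheroid_concat f' g)"
        using eq[OF f'] eq[OF f' g] by simp
    qed
    then show ?thesis using eq[OF f' g] by simp
  qed
  have "(\<Union>f'\<in>spheroid_class n X x f. \<Union>g'\<in>spheroid_class n X x g. spheroid_class n X x (spheroid_concat f' g'))
      = (\<Union>g'\<in>spheroid_class n X x g. spheroid_class n X x (spheroid_concat f g'))"
  proof (rule UN_spheroid_class_eq[OF assms(2)])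
    fix f' assume "rel_homotopic n X x f f'"
    then show "(\<Union>g'\<in>spheroid_class n X x g. spheroid_class n X x (spheroid_concat f' g'))
      = (\<Union>g'\<in>spheroid_class n X x g. spheroid_class n X x (spheroid_concat f g'))"
      using inner f by simp
  qed
  also note inner[OF f]
  finally show ?thesis by (simp add: homotopy_group_def)
qed

lemma spheroids_concat:
  "n \<ge> 1 \<Longrightarrow> f \<in> spheroids n X x \<Longrightarrow> g \<in> spheroids n X x \<Longrightarrow> spheroid_concat f g \<in> spheroids n X x"
  unfolding spheroids_rel by (rule rel_homotopic_concat)

lemma comp_spheroid_concat: "p \<circ> spheroid_concat f g = spheroid_concat (p \<circ> f) (p \<circ> g)"
  by (auto simp: spheroid_concat_def fun_eq_iff)

lemma homotopy_group_induced_hom: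
  assumes "n \<ge> 1" "continuous_map X Y p"
  shows "homotopy_group_induced n Y (p x) p \<in> hom (homotopy_group n X x) (homotopy_group n Y (p x))"
proof (rule homI)
  have sph: "p \<circ> f \<in> spheroids n Y (p x)" if "f \<in> spheroids n X x" for f
    using that assms(2) unfolding spheroids_rel by (rule rel_homotopic_compose)
  fix F assume "F \<in> carrier (homotopy_group n X x)"
  then obtain f where f: "f \<in> spheroids n X x" "F = spheroid_class n X x f"
    by (auto simp: homotopy_group_def)
  show "homotopy_group_induced n Y (p x) p F \<in> carrier (homotopy_group n Y (p x))"
    using sph[OF f(1)] homotopy_group_induced_class[OF f(1) assms(2)]
    by (simp add: f(2) homotopy_group_def)
  fix G assume "G \<in> carrier (homotopy_group n X x)"
  then obtain g where g: "g \<in> spheroids n X x" "G = spheroid_class n X x g"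
    by (auto simp: homotopy_group_def)
  show "homotopy_group_induced n Y (p x) p (F \<otimes>\<^bsub>homotopy_group n X x\<^esub> G)
    = homotopy_group_induced n Y (p x) p F \<otimes>\<^bsub>homotopy_group n Y (p x)\<^esub> homotopy_group_induced n Y (p x) p G"
    using f g sph assms
    by (simp add: homotopy_group_mult_class homotopy_group_induced_class spheroids_concat comp_spheroid_concat)
qed

text \<open>Points outside the space all have the empty path component; placing \<open>y\<close> in
  the space excludes an equality of two empty sets.\<close>

lemma path_component_of_set_eq_iff:
  assumes "y \<in> topspace X"
  shows "path_component_of_set X x = path_component_of_set X y \<longleftrightarrow> path_component_of X x y"
  using assms path_component_of_equiv path_component_of_refl path_component_of_sym path_component_of_trans
  by (smt (verit, ccfv_threshold) Collect_cong mem_Collect_eq)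

lemma path_component_of_map:
  "path_component_of X x y \<Longrightarrow> continuous_map X Y p \<Longrightarrow> path_component_of Y (p x) (p y)"
  unfolding path_component_of_def by (metis comp_apply pathin_compose)

text \<open>The hypothesis says that \<open>p\<close> has, through every point \<open>x\<close>, a section \<open>q x\<close> that is a homotopy
  inverse relative to \<open>x\<close>; so no change of base point enters.\<close>

lemma weak_homotopy_equivalence_pointed_sections:
  assumes p: "continuous_map X Y p" and surj: "p ` topspace X = topspace Y"
    and q: "\<And>x. x \<in> topspace X \<Longrightarrow> continuous_map Y X (q x)"
    and pq: "\<And>x y. x \<in> topspace X \<Longrightarrow> y \<in> topspace Y \<Longrightarrow> p (q x y) = y"
    and qx: "\<And>x. x \<in> topspace X \<Longrightarrow> q x (p x) = x"
    and qp: "\<And>x. x \<in> topspace X \<Longrightarrow> homotopic_with (\<lambda>k. k x = x) X X (q x \<circ> p) id"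
  shows "weak_homotopy_equivalence X Y p"
  unfolding weak_homotopy_equivalence_def
proof (intro conjI p allI impI ballI)
  \<comment> \<open>The path is the track of the single point \<open>z\<close> under the homotopy
    from \<open>q x \<circ> p\<close> to the identity.\<close>
  have path: "path_component_of X (q x (p z)) z" if xz: "x \<in> topspace X" "z \<in> topspace X" for x z
  proof -
    obtain h where h: "continuous_map (prod_topology unit_interval X) X h"
        "\<And>z. h (0, z) = q x (p z)" "\<And>z. h (1, z) = z"
      using qp[OF xz(1)] unfolding homotopic_with_def by auto
    have "continuous_map unit_interval (prod_topology unit_interval X) (\<lambda>t. (t, z))"
      using xz(2) by (intro continuous_map_pairedI) auto
    from continuous_map_compose[OF this h(1)] show ?thesis
      unfolding path_component_of_def pathin_def
      by (intro exI[of _ "\<lambda>t. h (t, z)"]) (simp add: h o_def)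
  qed
  have ind: "path_components_induced Y p (path_component_of_set X x) = path_component_of_set Y (p x)"
    if "x \<in> topspace X" for x
  proof -
    have "path_component_of_set Y (p z) = path_component_of_set Y (p x)" if "path_component_of X x z" for z
    proof -
      have "path_component_of Y (p z) (p x)"
        by (rule path_component_of_sym[OF path_component_of_map[OF that p]])
      moreover from this have "p x \<in> topspace Y" by (blast dest: path_component_in_topspace)
      ultimately show ?thesis by (simp add: path_component_of_set_eq_iff)
    qed
    then show ?thesis
      using that path_component_of_refl[of X x] unfolding path_components_induced_def by blast
  qed
  show "bij_betw (path_components_induced Y p) (path_components_of X) (path_components_of Y)"
    unfolding bij_betw_def
  proof
    show "inj_on (path_components_induced Y p) (path_components_of X)"
    proof (rule inj_onI)
      fix C D assume "C \<in> path_components_of X" "D \<in> path_components_of X"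
        and eq: "path_components_induced Y p C = path_components_induced Y p D"
      then obtain x z where xz: "x \<in> topspace X" "C = path_component_of_set X x"
          "z \<in> topspace X" "D = path_component_of_set X z"
        by (auto simp: path_components_of_def)
      have pz: "p z \<in> topspace Y" using surj xz by blast
      have "path_component_of Y (p x) (p z)"
        using eq unfolding xz(2,4) ind[OF xz(1)] ind[OF xz(3)] path_component_of_set_eq_iff[OF pz] .
      \<comment> \<open>The path in \<open>Y\<close> is pushed up by the single section
        \<open>q x\<close>: it starts at \<open>q x (p x) = x\<close>, and \<open>path\<close> joins
        its end to \<open>z\<close>.\<close>
      then have "path_component_of X x (q x (p z))"
        using path_component_of_map[OF _ q[OF xz(1)]] qx[OF xz(1)] by metis
      then have "path_component_of X x z"
        using path[OF xz(1,3)] path_component_of_trans by metis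
      then show "C = D" using path_component_of_set_eq_iff[OF xz(3)] by (simp add: xz)
    qed
    show "path_components_induced Y p ` path_components_of X = path_components_of Y"
      unfolding path_components_of_def surj[symmetric] by (auto simp: ind image_iff)
  qed
  fix n :: nat and x assume n: "1 \<le> n" and x: "x \<in> topspace X"
  have "bij_betw (homotopy_group_induced n Y (p x) p)
     (carrier (homotopy_group n X x)) (carrier (homotopy_group n Y (p x)))"
    unfolding bij_betw_def
  proof
    \<comment> \<open>The homotopy fixes \<open>x\<close> at all times and \<open>f\<close> sends
      the boundary to \<open>x\<close>, so composing with \<open>f\<close> yields a homotopy
      relative to the boundary.\<close>
    have retr: "rel_homotopic n X x (q x \<circ> (p \<circ> f)) f" if f: "f \<in> spheroids n X x" for f
    proof -
      have "homotopic_with (\<lambda>k. \<forall>u\<in>cube_boundary n. k u = x) (cube n) X ((q x \<circ> p) \<circ> f) (id \<circ> f)"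
        by (rule homotopic_with_compose_continuous_map_right[OF qp[OF x]])
          (use f in \<open>auto simp: spheroids_def\<close>)
      then show ?thesis by (simp add: rel_homotopic_def o_assoc)
    qed
    show "inj_on (homotopy_group_induced n Y (p x) p) (carrier (homotopy_group n X x))"
    proof (rule inj_onI)
      fix F G
      assume "F \<in> carrier (homotopy_group n X x)" "G \<in> carrier (homotopy_group n X x)"
        and eq: "homotopy_group_induced n Y (p x) p F = homotopy_group_induced n Y (p x) p G"
      then obtain f g where f: "f \<in> spheroids n X x" "F = spheroid_class n X x f"
          and g: "g \<in> spheroids n X x" "G = spheroid_class n X x g"
        by (auto simp: homotopy_group_def)
      have "p \<circ> g \<in> spheroids n Y (p x)"
        using rel_homotopic_compose[OF _ p] g(1) by (simp add: spheroids_rel)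
      then have "rel_homotopic n Y (p x) (p \<circ> f) (p \<circ> g)"
        using eq f g p by (simp add: homotopy_group_induced_class spheroid_class_eq_iff)
      then have "rel_homotopic n X (q x (p x)) (q x \<circ> (p \<circ> f)) (q x \<circ> (p \<circ> g))"
        by (rule rel_homotopic_compose[OF _ q[OF x]])
      then have "rel_homotopic n X x f g"
        using retr[OF f(1)] retr[OF g(1)] qx[OF x]
        by (metis rel_homotopic_sym rel_homotopic_trans)
      then show "F = G" using f g by (simp add: spheroid_class_eqI)
    qed
    have "spheroid_class n Y (p x) g \<in> homotopy_group_induced n Y (p x) p ` carrier (homotopy_group n X x)"
      if g: "g \<in> spheroids n Y (p x)" for g
    proof -
      have f: "q x \<circ> g \<in> spheroids n X x"
        using rel_homotopic_compose[OF _ q[OF x], of n "p x" g g] g qx[OF x]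
        by (simp add: spheroids_rel)
      have "rel_homotopic n Y (p x) (p \<circ> (q x \<circ> g)) g"
        unfolding rel_homotopic_def
      \<comment> \<open>\<open>pq\<close> speaks of points of \<open>Y\<close> only, so the two maps
        agree on the cube but need not be equal as functions.\<close>
      proof (rule homotopic_with_equal)
        show "\<forall>u\<in>cube_boundary n. (p \<circ> (q x \<circ> g)) u = p x" "\<forall>u\<in>cube_boundary n. g u = p x"
          using f g qx[OF x] by (auto simp: spheroids_def)
        show "continuous_map (cube n) Y (p \<circ> (q x \<circ> g))"
          using f p by (auto simp: spheroids_def intro: continuous_map_compose)
        show "(p \<circ> (q x \<circ> g)) u = g u" if "u \<in> topspace (cube n)" for u
        proof -
          have "g u \<in> topspace Y" using g that by (auto simp: spheroids_def continuous_map_def)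
          then show ?thesis using pq[OF x] by simp
        qed
      qed
      then have "spheroid_class n Y (p x) g
          = homotopy_group_induced n Y (p x) p (spheroid_class n X x (q x \<circ> g))"
        by (simp add: homotopy_group_induced_class[OF f p] spheroid_class_eqI)
      then show ?thesis using f by (auto simp: homotopy_group_def)
    qed
    then have "carrier (homotopy_group n Y (p x)) \<subseteq> homotopy_group_induced n Y (p x) p ` carrier (homotopy_group n X x)"
      by (auto simp: homotopy_group_def)
    moreover have "homotopy_group_induced n Y (p x) p ` carrier (homotopy_group n X x) \<subseteq> carrier (homotopy_group n Y (p x))"
      using homotopy_group_induced_hom[OF n p, of x] unfolding hom_def by (simp add: image_subset_iff_funcset)
    ultimately show "homotopy_group_induced n Y (p x) p ` carrier (homotopy_group n X x) = carrier (homotopy_group n Y (p x))"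
      by (rule subset_antisym[rotated])
  qed
  then show "homotopy_group_induced n Y (p x) p \<in> iso (homotopy_group n X x) (homotopy_group n Y (p x))"
    using homotopy_group_induced_hom[OF n p] by (simp add: iso_def)
qed

lemma homotopy_equivalence_section:
  assumes "continuous_map X Y p" "continuous_map Y X q"
    and "\<And>y. y \<in> topspace Y \<Longrightarrow> p (q y) = y"
    and "homotopic_with (\<lambda>_. True) X X (q \<circ> p) id"
  shows "homotopy_equivalence X Y p"
  unfolding homotopy_equivalence_def using assms by (blast intro: homotopic_with_id2)

text \<open>The lift sees only the starting point and the current value of the homotopy, not the
  path travelled. Its continuity is therefore that of a composite, whatever the test space.\<close>

lemma homotopy_lifting_connection:
  assumes \<Phi>: "continuous_map (prod_topology X Y) X (\<lambda>(x, y). \<Phi> x y)"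
    and p\<Phi>: "\<And>x y. x \<in> topspace X \<Longrightarrow> y \<in> topspace Y \<Longrightarrow> p (\<Phi> x y) = y"
    and \<Phi>p: "\<And>x. x \<in> topspace X \<Longrightarrow> \<Phi> x (p x) = x"
  shows "homotopy_lifting Z X Y p"
  unfolding homotopy_lifting_def
proof (intro allI impI, elim conjE)
  let ?P = "prod_topology unit_interval Z"
  fix f h assume f: "continuous_map Z X f" and h: "continuous_map ?P Y h"
    and h0: "\<forall>z\<in>topspace Z. h (0, z) = p (f z)"
  have "continuous_map ?P (prod_topology X Y) (\<lambda>w. (f (snd w), h w))"
    using continuous_map_compose[OF continuous_map_snd f] h
    by (intro continuous_map_pairedI) (simp_all add: o_def)
  from continuous_map_compose[OF this \<Phi>]
  have "continuous_map ?P X (\<lambda>w. \<Phi> (f (snd w)) (h w))" by (simp add: o_def)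
  moreover have fz: "f z \<in> topspace X" if "z \<in> topspace Z" for z
    using f that by (auto simp: continuous_map_def)
  moreover have "h (t, z) \<in> topspace Y" if "t \<in> {0..1}" "z \<in> topspace Z" for t z
    using h that by (auto simp: continuous_map_def Pi_iff)
  ultimately show "\<exists>H. continuous_map ?P X H \<and> (\<forall>z\<in>topspace Z. H (0, z) = f z) \<and>
      (\<forall>t\<in>{0..1}. \<forall>z\<in>topspace Z. p (H (t, z)) = h (t, z))"
    by (intro exI[of _ "\<lambda>w. \<Phi> (f (snd w)) (h w)"]) (simp add: h0 p\<Phi> \<Phi>p)
qed


section \<open>A uniform random variable\<close>

lemma sets_Collect_discrete:
  assumes "f \<in> M \<rightarrow>\<^sub>M count_space S"
  shows "{x \<in> space M. P (f x)} \<in> sets M"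
proof -
  have "{x \<in> space M. P (f x)} = f -` {s \<in> S. P s} \<inter> space M"
    using measurable_space[OF assms] by auto
  then show ?thesis using measurable_sets[OF assms, of "{s \<in> S. P s}"] by simp
qed

text \<open>\<open>null_cover\<close> is the trace of the isomorphism with the interval. Uniformity
  of \<open>u\<close> does not imply it: on the unit square with the first coordinate as label, the
  diagonal is null but has full image. Labels lie strictly between 0 and 1 at every point, so that
  \<open>u x \<le> 0\<close> never holds and \<open>u x \<le> 1\<close> always does.\<close>

locale uniform_label = prob_space M for M :: "'w measure" +
  fixes u :: "'w \<Rightarrow> real" and A :: "'w set"
  assumes label_measurable [measurable]: "u \<in> borel_measurable M"
    and label_range: "x \<in> space M \<Longrightarrow> 0 < u x \<and> u x < 1"
    and label_uniform: "0 \<le> a \<Longrightarrow> a \<le> 1 \<Longrightarrow> prob {x \<in> space M. u x \<le> a} = a"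
    and full_set: "A \<in> events" "prob A = 1"
    and null_cover: "N \<in> null_sets M \<Longrightarrow> 0 < e \<Longrightarrow>
          \<exists>U. open U \<and> u ` (N \<inter> A) \<subseteq> U \<and> prob {x \<in> space M. u x \<in> U} < e"

text \<open>The isomorphism is measurable only for the completion and defined only on
  \<open>A0\<close>. It is replaced by a function measurable for \<open>M\<close> that agrees with
  it on a set \<open>A\<close> of full measure; there null sets have Lebesgue null images, and outer
  regularity gives \<open>null_cover\<close>.\<close>

lemma nonatomic_standard_prob_space_label:
  fixes M :: "'w measure"
  assumes "nonatomic_standard_prob_space M"
  obtains u A where "uniform_label M u A"
proof -
  interpret prob_space M using assms by (simp add: nonatomic_standard_prob_space_def)
  let ?N = "completion M" and ?L = "lebesgue_on {0..1::real}"
  obtain A0 B \<phi> where A0: "A0 \<in> sets ?N" "space ?N - A0 \<in> null_sets ?N"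
    and B: "B \<in> sets ?L" "space ?L - B \<in> null_sets ?L" and bij: "bij_betw \<phi> A0 B"
    and \<phi>: "\<phi> \<in> restrict_space ?N A0 \<rightarrow>\<^sub>M restrict_space ?L B"
    and inv: "the_inv_into A0 \<phi> \<in> restrict_space ?L B \<rightarrow>\<^sub>M restrict_space ?N A0"
    and distr: "distr (restrict_space ?N A0) (restrict_space ?L B) \<phi> = restrict_space ?L B"
    using assms unfolding nonatomic_standard_prob_space_def iso_mod_null_def by blast
  have A0s: "A0 \<subseteq> space M" using sets.sets_into_space[OF A0(1)] by simp
  have B01: "B \<subseteq> {0..1}" using sets.sets_into_space[OF B(1)] by simp
  have Bleb: "B \<in> sets lebesgue" using B(1) by (auto simp: sets_restrict_space)
  have pushforward: "emeasure ?N (\<phi> -` Y \<inter> A0) = emeasure lebesgue Y"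
    if Y: "Y \<in> sets lebesgue" "Y \<subseteq> B" for Y
  proof -
    have YL: "Y \<in> sets ?L" using Y B01 by (auto simp: sets_restrict_space)
    then have Y': "Y \<in> sets (restrict_space ?L B)" using Y(2) by (auto simp: sets_restrict_space)
    have "emeasure (restrict_space ?L B) Y = emeasure (restrict_space ?N A0) (\<phi> -` Y \<inter> space (restrict_space ?N A0))"
      by (subst distr[symmetric], rule emeasure_distr[OF \<phi> Y'])
    also have "space (restrict_space ?N A0) = A0" using A0s by (auto simp: space_restrict_space)
    also have "emeasure (restrict_space ?N A0) (\<phi> -` Y \<inter> A0) = emeasure ?N (\<phi> -` Y \<inter> A0)"
      using A0 by (intro emeasure_restrict_space) auto
    also have "emeasure (restrict_space ?L B) Y = emeasure ?L Y"
      using B(1) Y(2) by (intro emeasure_restrict_space) (auto simp: sets.Int_space_eq2)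
    also have "\<dots> = emeasure lebesgue Y"
      using Y(2) B01 by (intro emeasure_restrict_space) auto
    finally show ?thesis by simp
  qed
  define \<phi>0 where "\<phi>0 = (\<lambda>x. if x \<in> A0 then \<phi> x else 0)"
  have "\<phi>0 \<in> borel_measurable ?N"
  proof -
    have "(\<lambda>x::real. x) \<in> restrict_space ?L B \<rightarrow>\<^sub>M borel"
      by (intro measurable_restrict_space1) (auto intro: measurable_completion)
    from measurable_compose[OF \<phi> this] have "\<phi> \<in> restrict_space ?N A0 \<rightarrow>\<^sub>M borel" .
    moreover have "{x \<in> space M. x \<in> A0} = A0" using A0s by auto
    ultimately show ?thesis unfolding \<phi>0_def
      using A0(1) by (subst measurable_If_restrict_space_iff) auto
  qed
  then obtain g where g [measurable]: "g \<in> borel_measurable M" and "AE x in M. \<phi>0 x = g x"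
    using completion_ex_borel_measurable_real by blast
  then obtain N1 where N1: "N1 \<in> null_sets M" "{x \<in> space M. \<phi>0 x \<noteq> g x} \<subseteq> N1"
    unfolding eventually_ae_filter by blast
  obtain N2 where N2: "N2 \<in> null_sets M" "space M - A0 \<subseteq> N2"
    using A0(2) by (auto simp: null_sets_completion_iff2)
  have g_law: "emeasure M {x \<in> space M. g x \<in> X} = emeasure lebesgue (X \<inter> {0..1})"
    if X: "X \<in> sets borel" for X
  proof -
    have Xl: "X \<in> sets lebesgue" using X by (simp add: sets_completionI_sets)
    have ev: "{x \<in> space M. g x \<in> X} \<in> sets M" using X by measurable
    have "emeasure M {x \<in> space M. g x \<in> X} = emeasure ?N {x \<in> space M. g x \<in> X}"
      using ev by simp
    also have "\<dots> = emeasure ?N (\<phi> -` (X \<inter> B) \<inter> A0)"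
    proof (rule emeasure_eq_AE)
      have "AE x in M. x \<notin> N1 \<union> N2" by (rule AE_not_in) (use N1 N2 in auto)
      then have "AE x in M. x \<in> {x \<in> space M. g x \<in> X} \<longleftrightarrow> x \<in> \<phi> -` (X \<inter> B) \<inter> A0"
      proof (rule AE_mp, intro AE_I2 impI)
        fix x assume "x \<in> space M" "x \<notin> N1 \<union> N2"
        then have "x \<in> A0" "\<phi>0 x = g x" using N1(2) N2(2) by auto
        then have "x \<in> A0" "g x = \<phi> x" "\<phi> x \<in> B"
          using bij_betwE[OF bij] by (auto simp: \<phi>0_def)
        then show "x \<in> {x \<in> space M. g x \<in> X} \<longleftrightarrow> x \<in> \<phi> -` (X \<inter> B) \<inter> A0"
          using \<open>x \<in> space M\<close> by auto
      qed
      then show "AE x in ?N. x \<in> {x \<in> space M. g x \<in> X} \<longleftrightarrow> x \<in> \<phi> -` (X \<inter> B) \<inter> A0"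
        by (rule AE_completion)
      have "X \<inter> B \<in> sets (restrict_space ?L B)" 
        using Xl Bleb B(1) B01 by (subst sets_restrict_space_iff) (auto simp: sets_restrict_space_iff)
      from measurable_sets[OF \<phi> this] show "\<phi> -` (X \<inter> B) \<inter> A0 \<in> sets ?N"
        using A0s A0(1) by (auto simp: space_restrict_space sets_restrict_space_iff Int_absorb2 Int_absorb1)
    qed (use ev in auto)
    also have "\<dots> = emeasure lebesgue (X \<inter> B)"
      using Xl Bleb by (intro pushforward) auto
    also have "\<dots> = emeasure lebesgue (X \<inter> {0..1})"
    proof (rule emeasure_eq_AE)
      have "{0..1} - B \<in> null_sets lebesgue"
        using B(2) by (auto simp: null_sets_restrict_space)
      then have "AE x in lebesgue. x \<notin> {0..1} - B" by (rule AE_not_in)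
      then show "AE x in lebesgue. x \<in> X \<inter> B \<longleftrightarrow> x \<in> X \<inter> {0..1}"
        by (rule eventually_mono) (use B01 in auto)
    qed (use Xl Bleb in auto)
    finally show ?thesis .
  qed
  \<comment> \<open>Values of \<open>g\<close> outside the open interval occur on a null set only;
    \<open>1/2\<close> is an arbitrary replacement.\<close>
  define u where "u = (\<lambda>x. if 0 < g x \<and> g x < 1 then g x else 1/2)"
  have u [measurable]: "u \<in> borel_measurable M" unfolding u_def by measurable
  define N3 where "N3 = {x \<in> space M. g x \<in> - {0<..<1}}"
  have N3: "N3 \<in> null_sets M"
  proof -
    have "emeasure M N3 = emeasure lebesgue {0, 1::real}"
    proof -
      have "- {0<..<1} \<inter> {0..1} = {0, 1::real}" by auto
      then show ?thesis unfolding N3_def by (subst g_law) simp_all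
    qed
    also have "\<dots> = 0" by (simp add: emeasure_lborel_countable)
    finally show ?thesis unfolding N3_def by (intro null_setsI) measurable
  qed
  have u_law: "emeasure M {x \<in> space M. u x \<in> X} = emeasure lebesgue (X \<inter> {0..1})"
    if X: "X \<in> sets borel" for X
  proof -
    have "emeasure M {x \<in> space M. u x \<in> X} = emeasure M {x \<in> space M. g x \<in> X}"
    proof (rule emeasure_eq_AE)
      show "AE x in M. x \<in> {x \<in> space M. u x \<in> X} \<longleftrightarrow> x \<in> {x \<in> space M. g x \<in> X}"
        by (rule AE_mp[OF AE_not_in[OF N3]]) (auto simp: N3_def u_def)
    qed (use X in measurable)
    then show ?thesis by (simp add: g_law[OF X])
  qed
  define A where "A = space M - (N1 \<union> N2 \<union> N3)"
  have N123: "N1 \<union> N2 \<union> N3 \<in> null_sets M" using N1 N2 N3 by auto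
  have uA: "x \<in> A0 \<and> u x = \<phi> x" if "x \<in> A" for x
  proof -
    have "x \<in> space M" "x \<notin> N1" "x \<notin> N2" "x \<notin> N3" using that by (auto simp: A_def)
    then have "x \<in> A0" "\<phi>0 x = g x" "0 < g x" "g x < 1" using N1(2) N2(2) by (auto simp: N3_def)
    then show ?thesis by (simp add: u_def \<phi>0_def)
  qed
  have "uniform_label M u A"
  proof unfold_locales
    show "0 < u x \<and> u x < 1" if "x \<in> space M" for x by (auto simp: u_def)
    show "prob {x \<in> space M. u x \<le> a} = a" if "0 \<le> a" "a \<le> 1" for a
    proof -
      have I: "{..a} \<inter> {0..1} = {0..a}" using that by auto
      have "emeasure M {x \<in> space M. u x \<in> {..a}} = emeasure lebesgue {0..a}"
        using u_law[of "{..a}"] unfolding I by simp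
      then show ?thesis using that by (simp add: measure_def)
    qed
    show "A \<in> events" unfolding A_def using N123 by auto
    show "prob A = 1" unfolding A_def using N123 by (subst measure_Diff_null_set) (auto simp: prob_space)
    fix N and e :: real assume N: "N \<in> null_sets M" and e: "0 < e"
    define Y where "Y = \<phi> ` (N \<inter> A0)"
    have inj: "inj_on \<phi> A0" and im: "\<phi> ` A0 = B" using bij by (auto simp: bij_betw_def)
    have YB: "Y \<subseteq> B" using im by (auto simp: Y_def)
    have "N \<inter> A0 \<in> sets ?N" using N A0 by auto
    then have "N \<inter> A0 \<in> sets (restrict_space ?N A0)" by (auto simp: sets_restrict_space)
    moreover have "space (restrict_space ?L B) = B" using B01 by (auto simp: space_restrict_space)
    \<comment> \<open>Images under measurable maps need not be measurable; \<open>Y\<close> is,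
      being a preimage under the measurable inverse.\<close>
    ultimately have "the_inv_into A0 \<phi> -` (N \<inter> A0) \<inter> B \<in> sets (restrict_space ?L B)"
      using measurable_sets[OF inv, of "N \<inter> A0"] by simp
    also have "the_inv_into A0 \<phi> -` (N \<inter> A0) \<inter> B = Y"
      unfolding Y_def im[symmetric] using inj by (auto simp: the_inv_into_f_f)
    finally have Yl: "Y \<in> sets lebesgue" using Bleb by (auto simp: sets_restrict_space intro!: sets.Int)
    have "emeasure lebesgue Y = emeasure ?N (\<phi> -` Y \<inter> A0)" using pushforward[OF Yl YB] by simp
    also have "\<phi> -` Y \<inter> A0 = N \<inter> A0" unfolding Y_def using inj by (auto simp: inj_on_def)
    also have "emeasure ?N (N \<inter> A0) = 0"
      using N A0 by (metis Int_commute null_setsD1 null_sets_completionI null_set_Int2)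
    finally have Y0: "emeasure lebesgue Y = 0" .
    obtain T where T: "open T" "Y \<subseteq> T" "T - Y \<in> lmeasurable" "emeasure lebesgue (T - Y) < ennreal e"
      using sets_lebesgue_outer_open[OF Yl e] by metis
    have Tl: "T \<in> sets lebesgue" using T(1) by auto
    have "emeasure M {x \<in> space M. u x \<in> T} = emeasure lebesgue (T \<inter> {0..1})"
      using T(1) by (intro u_law) auto
    also have "\<dots> \<le> emeasure lebesgue ((T - Y) \<union> Y)"
      using Tl Yl by (intro emeasure_mono) auto
    also have "\<dots> \<le> emeasure lebesgue (T - Y) + emeasure lebesgue Y"
      using Tl Yl by (intro emeasure_subadditive) auto
    also have "\<dots> < ennreal e" using T(4) Y0 by simp
    finally have "prob {x \<in> space M. u x \<in> T} < e"
      using e by (simp add: emeasure_eq_measure ennreal_less_iff)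
    moreover have "u ` (N \<inter> A) \<subseteq> T"
      using T(2) uA by (auto simp: Y_def)
    ultimately show "\<exists>U. open U \<and> u ` (N \<inter> A) \<subseteq> U \<and> prob {x \<in> space M. u x \<in> U} < e"
      using T(1) by blast
  qed (rule u)
  then show thesis ..
qed


context uniform_label
begin

text \<open>If a set \<open>T\<close> of negligible values had a preimage of positive measure, well-order it so that proper
  initial segments have null preimages, and cover these by open sets of small measure in the label.
  The set \<open>W\<close> of pairs \<open>(x, y)\<close> for which the label of \<open>y\<close> lies in the cover belonging to \<open>f x\<close> has
  small vertical but large horizontal sections.\<close>

lemma AE_positive_fibre:
  fixes f :: "'w \<Rightarrow> 's"
  assumes f: "f \<in> M \<rightarrow>\<^sub>M count_space S"
  shows "AE t in M. prob {x \<in> space M. f x = f t} > 0"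
proof -
  define m where "m T = prob {x \<in> space M. f x \<in> T}" for T
  have ev [measurable]: "{x \<in> space M. P (f x)} \<in> events" for P
    by (rule sets_Collect_discrete[OF f])
  have m_mono: "m T \<le> m T'" if "T \<subseteq> T'" for T T'
    unfolding m_def using that by (intro finite_measure_mono ev) auto
  have m_Un: "m (T \<union> T') \<le> m T + m T'" for T T'
  proof -
    have "m (T \<union> T') = prob ({x \<in> space M. f x \<in> T} \<union> {x \<in> space M. f x \<in> T'})"
      unfolding m_def by (rule arg_cong[where f = prob]) auto
    also have "\<dots> \<le> m T + m T'" unfolding m_def by (intro measure_Un_le ev)
    finally show ?thesis .
  qed
  define Z where "Z = {s. m {s} = 0}"
  have "m Z = 0"
  proof (rule ccontr)
    assume "m Z \<noteq> 0"
    then have mZ: "m Z > 0" by (simp add: m_def zero_less_measure_iff)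
    obtain r :: "'s rel" where r: "Well_order r" "Field r = UNIV"
      using well_ordering[where 'a = 's] by (elim exE conjE)
    have wf: "wf (r - Id)" using r(1) by (simp add: well_order_on_def)
    have "total_on UNIV r" "refl_on UNIV r"
      using r unfolding well_order_on_def linear_order_on_def partial_order_on_def preorder_on_def by simp_all
    then have total: "(a, b) \<in> r \<or> (b, a) \<in> r" for a b
      unfolding total_on_def refl_on_def by (cases "a = b") auto
    \<comment> \<open>Either \<open>Z\<close> itself qualifies, or some least \<open>s0\<close> has
      an initial segment in \<open>Z\<close> of positive measure. In the latter case the part
      strictly below \<open>s0\<close> qualifies: it loses only the negligible value
      \<open>s0\<close>, and by minimality its own segments are null.\<close>
    have "\<exists>T. m T > 0 \<and> (\<forall>s\<in>T. m {s' \<in> T. (s', s) \<in> r} = 0)"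
    proof (cases "\<exists>s\<in>Z. m {s' \<in> Z. (s', s) \<in> r} > 0")
      case True
      then obtain s0 where s0: "s0 \<in> Z" "m {s' \<in> Z. (s', s0) \<in> r} > 0"
          "\<And>s. (s, s0) \<in> r - Id \<Longrightarrow> \<not> (s \<in> Z \<and> m {s' \<in> Z. (s', s) \<in> r} > 0)"
      proof -
        let ?Q = "{s \<in> Z. m {s' \<in> Z. (s', s) \<in> r} > 0}"
        from True obtain s1 where "s1 \<in> ?Q" by blast
        from wfE_min[OF wf this] obtain s0 where "s0 \<in> ?Q" "\<And>s. (s, s0) \<in> r - Id \<Longrightarrow> s \<notin> ?Q"
          by blast
        then show ?thesis by (intro that[of s0]) auto
      qed
      define T where "T = {s \<in> Z. (s, s0) \<in> r - Id}"
      have "m {s' \<in> Z. (s', s0) \<in> r} \<le> m (T \<union> {s0})" by (rule m_mono) (auto simp: T_def)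
      also have "\<dots> \<le> m T + m {s0}" by (rule m_Un)
      also have "m {s0} = 0" using s0(1) by (simp add: Z_def)
      finally have "m T > 0" using s0(2) by simp
      moreover have "m {s' \<in> T. (s', s) \<in> r} = 0" if "s \<in> T" for s
      proof -
        have "m {s' \<in> T. (s', s) \<in> r} \<le> m {s' \<in> Z. (s', s) \<in> r}" by (rule m_mono) (auto simp: T_def)
        also have "\<dots> \<le> 0" using s0(3)[of s] that by (auto simp: T_def)
        finally show ?thesis by (simp add: m_def measure_le_0_iff)
      qed
      ultimately show ?thesis by blast
    next
      case False
      then have "\<forall>s\<in>Z. m {s' \<in> Z. (s', s) \<in> r} = 0"
        by (metis m_def zero_less_measure_iff)
      with mZ show ?thesis by blast
    qed
    then obtain T where mT: "m T > 0" and T0: "\<And>s. s \<in> T \<Longrightarrow> m {s' \<in> T. (s', s) \<in> r} = 0" by blast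
    \<comment> \<open>The horizontal sections force \<open>W\<close> to have measure at least
      \<open>m T * m T\<close>; half of it as an upper bound is contradictory.\<close>
    define e where "e = (m T)\<^sup>2 / 2"
    have e: "e > 0" using mT by (simp add: e_def)
    define Q where "Q s V \<longleftrightarrow> open V \<and> (\<forall>x\<in>A. f x \<in> T \<and> (f x, s) \<in> r \<longrightarrow> u x \<in> V)
        \<and> prob {x \<in> space M. u x \<in> V} < e" for s V
    have "\<exists>V. Q s V" if "s \<in> T" for s
    proof -
      have "{x \<in> space M. f x \<in> {s' \<in> T. (s', s) \<in> r}} \<in> null_sets M"
        using T0[OF that] by (intro null_setsI ev) (simp add: m_def emeasure_eq_measure)
      from null_cover[OF this e] obtain V where V: "open V"
          "u ` ({x \<in> space M. f x \<in> {s' \<in> T. (s', s) \<in> r}} \<inter> A) \<subseteq> V"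
          "prob {x \<in> space M. u x \<in> V} < e" by blast
      moreover have "u x \<in> V" if "x \<in> A" "f x \<in> T" "(f x, s) \<in> r" for x
        using V(2) that sets.sets_into_space[OF full_set(1)] by (auto simp: image_subset_iff)
      ultimately show ?thesis unfolding Q_def by blast
    qed
    then have "\<exists>U. \<forall>s\<in>T. Q s (U s)" by (intro bchoice ballI)
    then obtain U where "\<forall>s\<in>T. Q s (U s)" by (rule exE)
    then have U: "\<And>s. s \<in> T \<Longrightarrow> open (U s)"
        "\<And>s x. s \<in> T \<Longrightarrow> x \<in> A \<Longrightarrow> f x \<in> T \<Longrightarrow> (f x, s) \<in> r \<Longrightarrow> u x \<in> U s"
        "\<And>s. s \<in> T \<Longrightarrow> prob {x \<in> space M. u x \<in> U s} < e"
      unfolding Q_def by blast+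
    define W where "W = {z \<in> space (M \<Otimes>\<^sub>M M). f (fst z) \<in> T \<and> u (snd z) \<in> U (f (fst z))}"
    have W: "W \<in> sets (M \<Otimes>\<^sub>M M)"
    proof -
      \<comment> \<open>The choice of \<open>U s\<close> depends on \<open>s\<close> in no
        controlled way. Openness reduces membership to rational intervals, and then
        \<open>{a<..<b} \<subseteq> U (f x)\<close> defines an event because every subset of
        \<open>S\<close> is measurable.\<close>
      have "W = (\<Union>(a, b)\<in>\<rat> \<times> \<rat>. {x \<in> space M. f x \<in> T \<and> {a<..<b} \<subseteq> U (f x)} \<times> {y \<in> space M. u y \<in> {a<..<b}})"
        (is "_ = ?W")
      proof
        show "W \<subseteq> ?W"
        proof
          fix z assume z: "z \<in> W"
          then have "open (U (f (fst z)))" "u (snd z) \<in> U (f (fst z))" using U(1) by (auto simp: W_def)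
          then obtain d where d: "d > 0" "\<And>v. \<bar>v - u (snd z)\<bar> < d \<Longrightarrow> v \<in> U (f (fst z))"
            unfolding open_dist by (auto simp: dist_real_def)
          obtain a where a: "a \<in> \<rat>" "u (snd z) - d < a" "a < u (snd z)"
            using Rats_dense_in_real[of "u (snd z) - d" "u (snd z)"] d(1) by auto
          obtain b where b: "b \<in> \<rat>" "u (snd z) < b" "b < u (snd z) + d"
            using Rats_dense_in_real[of "u (snd z)" "u (snd z) + d"] d(1) by auto
          have "{a<..<b} \<subseteq> U (f (fst z))" using a b by (auto intro!: d(2))
          then show "z \<in> ?W" using a b z
            by (intro UN_I[of "(a, b)"]) (auto simp: W_def space_pair_measure mem_Times_iff)
        qed
        show "?W \<subseteq> W" by (auto simp: W_def space_pair_measure)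
      qed
      also have "\<dots> \<in> sets (M \<Otimes>\<^sub>M M)"
      proof (rule sets.countable_UN')
        show "countable (\<rat> \<times> \<rat> :: (real \<times> real) set)" by (simp add: countable_rat)
        have "{x \<in> space M. f x \<in> T \<and> {a<..<b} \<subseteq> U (f x)} \<times> {y \<in> space M. u y \<in> {a<..<b}} \<in> sets (M \<Otimes>\<^sub>M M)" for a b
          by (intro pair_measureI ev) measurable
        then show "(\<lambda>(a, b). {x \<in> space M. f x \<in> T \<and> {a<..<b} \<subseteq> U (f x)} \<times> {y \<in> space M. u y \<in> {a<..<b}}) ` (\<rat> \<times> \<rat>)
            \<subseteq> sets (M \<Otimes>\<^sub>M M)" by auto
      qed
      finally show ?thesis .
    qed
    interpret pair: pair_prob_space M M ..
    have "emeasure (M \<Otimes>\<^sub>M M) W = (\<integral>\<^sup>+x. emeasure M (Pair x -` W) \<partial>M)"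
      by (rule emeasure_pair_measure_alt[OF W])
    also have "\<dots> \<le> (\<integral>\<^sup>+x. ennreal e \<partial>M)"
    proof (rule nn_integral_mono)
      fix x assume "x \<in> space M"
      show "emeasure M (Pair x -` W) \<le> ennreal e"
      proof (cases "f x \<in> T")
        case True
        then have "Pair x -` W \<subseteq> {y \<in> space M. u y \<in> U (f x)}" by (auto simp: W_def space_pair_measure)
        moreover have "{y \<in> space M. u y \<in> U (f x)} \<in> events"
          using measurable_sets[OF label_measurable borel_open[OF U(1)[OF True]]]
          by (simp add: vimage_def Int_def conj_commute)
        ultimately have "emeasure M (Pair x -` W) \<le> emeasure M {y \<in> space M. u y \<in> U (f x)}"
          by (rule emeasure_mono)
        also have "\<dots> \<le> ennreal e"
          using U(3)[OF True] by (simp add: emeasure_eq_measure ennreal_leI)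
        finally show ?thesis .
      next
        case False
        then have "Pair x -` W = {}" by (auto simp: W_def)
        then show ?thesis by simp
      qed
    qed
    also have "\<dots> = ennreal e" by (simp add: emeasure_space_1)
    finally have le: "emeasure (M \<Otimes>\<^sub>M M) W \<le> ennreal e" .
    have "ennreal (m T * m T) = ennreal (m T) * emeasure M ({x \<in> space M. f x \<in> T} \<inter> A)"
    proof -
      have "prob ({x \<in> space M. f x \<in> T} \<inter> A) = m T"
        unfolding m_def
      proof (rule measure_eq_AE)
        have "AE x in M. x \<in> A" using prob_eq_1[OF full_set(1)] full_set(2) by simp
        then show "AE x in M. x \<in> {x \<in> space M. f x \<in> T} \<inter> A \<longleftrightarrow> x \<in> {x \<in> space M. f x \<in> T}" by auto
      qed (intro ev sets.Int full_set)+
      then show ?thesis using mT by (simp add: emeasure_eq_measure ennreal_mult)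
    qed
    also have "\<dots> = (\<integral>\<^sup>+y. ennreal (m T) * indicator ({x \<in> space M. f x \<in> T} \<inter> A) y \<partial>M)"
      by (rule nn_integral_cmult_indicator[symmetric]) (intro sets.Int ev full_set)
    also have "\<dots> \<le> (\<integral>\<^sup>+y. emeasure M ((\<lambda>x. (x, y)) -` W) \<partial>M)"
    proof (rule nn_integral_mono)
      fix y assume y: "y \<in> space M"
      show "ennreal (m T) * indicator ({x \<in> space M. f x \<in> T} \<inter> A) y \<le> emeasure M ((\<lambda>x. (x, y)) -` W)"
      proof (cases "f y \<in> T \<and> y \<in> A")
        case True
        \<comment> \<open>Up to the null segment below \<open>f y\<close>, all of \<open>T\<close>
          lies above \<open>f y\<close>; whenever \<open>f x\<close> lies there,
          \<open>U (f x)\<close> contains the label of \<open>y\<close>.\<close>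
        have "m T \<le> m ({s \<in> T. (f y, s) \<in> r} \<union> {s \<in> T. (s, f y) \<in> r})"
          by (rule m_mono) (use total in auto)
        also have "\<dots> \<le> m {s \<in> T. (f y, s) \<in> r} + 0"
          using m_Un[of "{s \<in> T. (f y, s) \<in> r}" "{s \<in> T. (s, f y) \<in> r}"] T0[of "f y"] True by simp
        finally have "ennreal (m T) \<le> emeasure M {x \<in> space M. f x \<in> {s \<in> T. (f y, s) \<in> r}}"
          by (simp add: m_def emeasure_eq_measure)
        also have "\<dots> \<le> emeasure M ((\<lambda>x. (x, y)) -` W)"
        proof (rule emeasure_mono)
          show "{x \<in> space M. f x \<in> {s \<in> T. (f y, s) \<in> r}} \<subseteq> (\<lambda>x. (x, y)) -` W"
          proof
            fix x assume "x \<in> {x \<in> space M. f x \<in> {s \<in> T. (f y, s) \<in> r}}"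
            then show "x \<in> (\<lambda>x. (x, y)) -` W"
              using True y U(2)[of "f x" y] by (simp add: W_def space_pair_measure)
          qed
          show "(\<lambda>x. (x, y)) -` W \<in> events" by (rule sets_Pair2[OF W])
        qed
        finally show ?thesis using True y by simp
      qed (auto simp: indicator_def)
    qed
    also have "\<dots> = emeasure (M \<Otimes>\<^sub>M M) W"
      by (rule pair.emeasure_pair_measure_alt2[OF W, symmetric])
    also note le
    finally have "m T * m T \<le> e" using e by (simp add: ennreal_le_iff)
    then show False using mT by (simp add: e_def power2_eq_square)
  qed
  then have "{x \<in> space M. f x \<in> Z} \<in> null_sets M"
    by (intro null_setsI ev) (simp add: m_def emeasure_eq_measure)
  from AE_not_in[OF this] show ?thesis
    by (rule AE_mp) (auto simp: Z_def m_def zero_less_measure_iff)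
qed

end


section \<open>Distributions of discrete maps\<close>

context prob_space
begin

definition mass :: "('a \<Rightarrow> 's) \<Rightarrow> 's \<Rightarrow> real" where
  "mass f s = prob {x \<in> space M. f x = s}"

text \<open>Splitting along the countable range of \<open>f\<close> avoids the product of two
  discrete sigma-algebras, in which the diagonal of a very large set is not measurable.\<close>

lemma events_pred2:
  assumes "f \<in> M \<rightarrow>\<^sub>M count_space S" "g \<in> M \<rightarrow>\<^sub>M count_space S'" "countable (f ` space M)"
  shows "{x \<in> space M. P (f x) (g x)} \<in> events"
proof -
  have "{x \<in> space M. P (f x) (g x)}
      = (\<Union>s\<in>f ` space M. {x \<in> space M. f x = s} \<inter> {x \<in> space M. P s (g x)})" by auto
  also have "\<dots> \<in> events"
    by (intro sets.countable_UN'' assms(3) sets.Int sets_Collect_discrete[OF assms(1)] sets_Collect_discrete[OF assms(2)])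
  finally show ?thesis .
qed

lemma measurable_count_space_countable_range:
  assumes "f \<in> space M \<rightarrow> S" "countable (f ` space M)" "\<And>s. s \<in> f ` space M \<Longrightarrow> {x \<in> space M. f x = s} \<in> events"
  shows "f \<in> M \<rightarrow>\<^sub>M count_space S"
proof (rule measurableI)
  fix T
  have "f -` T \<inter> space M = (\<Union>s\<in>f ` space M \<inter> T. {x \<in> space M. f x = s})" by auto
  also have "\<dots> \<in> events" by (intro sets.countable_UN'' assms(3)) (use assms(2) in auto)
  finally show "f -` T \<inter> space M \<in> events" .
qed (use assms(1) in auto)

text \<open>Countable additivity, turned into an unordered sum over an arbitrary \<open>T\<close>:
  the range is numbered, and values outside it contribute zero.\<close>

lemma has_sum_mass:
  assumes f: "f \<in> M \<rightarrow>\<^sub>M count_space S" and C: "countable (f ` space M)"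
  shows "(mass f has_sum prob {x \<in> space M. f x \<in> T}) T"
proof -
  let ?C = "f ` space M"
  let ?n = "to_nat_on ?C"
  define B where "B n = {x \<in> space M. f x \<in> T \<and> ?n (f x) = n}" for n
  have inj: "inj_on ?n ?C" using C by (rule inj_on_to_nat_on)
  have "(\<lambda>n. prob (B n)) sums prob (\<Union>n. B n)"
    by (rule finite_measure_UNION)
      (auto simp: B_def disjoint_family_on_def intro!: sets_Collect_discrete[OF f])
  also have "(\<Union>n. B n) = {x \<in> space M. f x \<in> T}" by (auto simp: B_def)
  finally have "((\<lambda>n. prob (B n)) has_sum prob {x \<in> space M. f x \<in> T}) UNIV"
    by (rule sums_nonneg_imp_has_sum) simp
  also have "?this \<longleftrightarrow> ((\<lambda>n. prob (B n)) has_sum prob {x \<in> space M. f x \<in> T}) (?n ` (?C \<inter> T))"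
  proof (rule has_sum_cong_neutral)
    fix n assume "n \<in> UNIV - ?n ` (?C \<inter> T)"
    then have "B n = {}" by (auto simp: B_def)
    then show "prob (B n) = 0" by simp
  qed auto
  also have "\<dots> \<longleftrightarrow> ((\<lambda>n. prob (B n)) \<circ> ?n has_sum prob {x \<in> space M. f x \<in> T}) (?C \<inter> T)"
    by (rule has_sum_reindex) (use inj in \<open>auto intro: inj_on_subset\<close>)
  also have "\<dots> \<longleftrightarrow> (mass f has_sum prob {x \<in> space M. f x \<in> T}) T"
  proof (rule has_sum_cong_neutral)
    fix s assume "s \<in> T - ?C \<inter> T"
    then have empty: "{x \<in> space M. f x = s} = {}" by auto
    show "mass f s = 0" unfolding mass_def empty by simp
  next
    fix s assume s: "s \<in> (?C \<inter> T) \<inter> T"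
    then have "B (?n s) = {x \<in> space M. f x = s}" using inj by (auto simp: B_def inj_on_def)
    then show "((\<lambda>n. prob (B n)) \<circ> ?n) s = mass f s" by (simp add: mass_def)
  qed auto
  finally show ?thesis .
qed

text \<open>The masses at \<open>s\<close> differ by at most the probability that exactly one of
  \<open>f\<close>, \<open>g\<close> equals \<open>s\<close>. The events
  \<open>f = s \<noteq> g\<close> are disjoint for different \<open>s\<close> and lie in the set of
  disagreement, and so are the events \<open>g = s \<noteq> f\<close>; hence the factor 2.\<close>

lemma sum_mass_diff_le:
  assumes "f \<in> M \<rightarrow>\<^sub>M count_space S" "g \<in> M \<rightarrow>\<^sub>M count_space S" "countable (f ` space M)" "finite T"
  shows "(\<Sum>s\<in>T. \<bar>mass f s - mass g s\<bar>) \<le> 2 * prob {x \<in> space M. f x \<noteq> g x}"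
proof -
  note ev = events_pred2[OF assms(1-3)]
  have "\<bar>mass f s - mass g s\<bar> \<le> prob {x \<in> space M. f x = s \<and> g x \<noteq> s} + prob {x \<in> space M. f x \<noteq> s \<and> g x = s}" for s
  proof -
    have "mass f s = prob ({x \<in> space M. f x = s \<and> g x = s} \<union> {x \<in> space M. f x = s \<and> g x \<noteq> s})"
      unfolding mass_def by (rule arg_cong[where f = prob]) auto
    also have "\<dots> = prob {x \<in> space M. f x = s \<and> g x = s} + prob {x \<in> space M. f x = s \<and> g x \<noteq> s}"
      by (rule finite_measure_Union) (auto intro: ev)
    finally have f: "mass f s = \<dots>" .
    have "mass g s = prob ({x \<in> space M. f x = s \<and> g x = s} \<union> {x \<in> space M. f x \<noteq> s \<and> g x = s})"
      unfolding mass_def by (rule arg_cong[where f = prob]) auto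
    also have "\<dots> = prob {x \<in> space M. f x = s \<and> g x = s} + prob {x \<in> space M. f x \<noteq> s \<and> g x = s}"
      by (rule finite_measure_Union) (auto intro: ev)
    finally show ?thesis using f by (simp add: abs_le_iff measure_nonneg add_increasing add_increasing2)
  qed
  then have "(\<Sum>s\<in>T. \<bar>mass f s - mass g s\<bar>)
      \<le> (\<Sum>s\<in>T. prob {x \<in> space M. f x = s \<and> g x \<noteq> s}) + (\<Sum>s\<in>T. prob {x \<in> space M. f x \<noteq> s \<and> g x = s})"
    unfolding sum.distrib[symmetric] by (rule sum_mono)
  also have "(\<Sum>s\<in>T. prob {x \<in> space M. f x = s \<and> g x \<noteq> s}) = prob (\<Union>s\<in>T. {x \<in> space M. f x = s \<and> g x \<noteq> s})"
    by (rule finite_measure_finite_Union[symmetric, OF assms(4)])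
      (auto simp: disjoint_family_on_def intro!: ev[where P = "\<lambda>y z. y = _ \<and> z \<noteq> _"])
  also have "\<dots> \<le> prob {x \<in> space M. f x \<noteq> g x}" by (intro finite_measure_mono ev) auto
  also have "(\<Sum>s\<in>T. prob {x \<in> space M. f x \<noteq> s \<and> g x = s}) = prob (\<Union>s\<in>T. {x \<in> space M. f x \<noteq> s \<and> g x = s})"
    by (rule finite_measure_finite_Union[symmetric, OF assms(4)])
      (auto simp: disjoint_family_on_def intro!: ev[where P = "\<lambda>y z. y \<noteq> _ \<and> z = _"])
  also have "\<dots> \<le> prob {x \<in> space M. f x \<noteq> g x}" by (intro finite_measure_mono ev) auto
  finally show ?thesis by simp
qed

text \<open>Without atoms the distribution function is continuous and attains every level strictly
  between 0 and 1. It may be flat there, so the largest point of the level is used: it turns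
  \<open>F (w t) \<le> a\<close> into a bound on \<open>w t\<close>. The level 0 need not be
  attained and is reached as a limit.\<close>

lemma probability_integral_transform:
  fixes w :: "'a \<Rightarrow> real"
  assumes w [measurable]: "w \<in> borel_measurable M" and no_atom: "\<And>y. prob {x \<in> space M. w x = y} = 0"
  defines "F \<equiv> \<lambda>y. prob {x \<in> space M. w x \<le> y}"
  shows "F \<in> borel_measurable borel"
    and "0 \<le> a \<Longrightarrow> a \<le> 1 \<Longrightarrow> prob {t \<in> space M. F (w t) \<le> a} = a"
proof -
  have mono: "F y \<le> F z" if "y \<le> z" for y z
    unfolding F_def using that by (intro finite_measure_mono) auto
  then show F [measurable]: "F \<in> borel_measurable borel" by (intro borel_measurable_mono monoI)
  interpret D: real_distribution "distr M borel w" by (rule real_distribution_distr) measurable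
  have F: "F = cdf (distr M borel w)"
    unfolding F_def cdf_def by (auto simp: measure_distr vimage_def Int_def conj_commute)
  have "isCont F y" for y
    unfolding F D.isCont_cdf using no_atom[of y] by (simp add: measure_distr vimage_def Int_def conj_commute)
  then have cont: "continuous_on X F" for X by (simp add: continuous_at_imp_continuous_on)
  have mid: "prob {t \<in> space M. F (w t) \<le> a} = a" if a: "0 < a" "a < 1" for a
  proof -
    have "\<forall>\<^sub>F y in at_bot. F y < a" using order_tendstoD(2)[OF D.cdf_lim_at_bot a(1)] by (simp add: F)
    then obtain y1 where y1: "F y1 < a" by (auto simp: eventually_at_bot_linorder)
    have "\<forall>\<^sub>F y in at_top. F y > a" using order_tendstoD(1)[OF D.cdf_lim_at_top_prob a(2)] by (simp add: F)
    then obtain y2 where y2: "F y2 > a" by (auto simp: eventually_at_top_linorder)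
    have "y1 \<le> y2" using mono[of y2 y1] y1 y2 by linarith
    then obtain y0 where y0: "F y0 = a"
      using IVT'[of F y1 a y2] y1 y2 cont by auto
    define B where "B = {y. F y \<le> a}"
    have bdd: "bdd_above B"
      unfolding bdd_above_def B_def using y2 mono by (metis mem_Collect_eq linorder_not_le order_trans nle_le)
    have "closed B" unfolding B_def by (rule closed_Collect_le) (use cont in auto)
    then have Sup: "Sup B \<in> B" using bdd y0 by (intro closed_contains_Sup) (auto simp: B_def)
    have "y0 \<le> Sup B" using bdd y0 by (intro cSup_upper) (auto simp: B_def)
    then have "F (Sup B) = a" using Sup mono[of y0 "Sup B"] y0 by (simp add: B_def)
    moreover have "F (w t) \<le> a \<longleftrightarrow> w t \<le> Sup B" for t
      using Sup bdd mono[of "w t" "Sup B"] by (auto simp: B_def intro: cSup_upper)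
    ultimately show ?thesis by (simp add: F_def)
  qed
  assume a: "0 \<le> a" "a \<le> 1"
  consider "a = 0" | "0 < a" "a < 1" | "a = 1" using a by linarith
  then show "prob {t \<in> space M. F (w t) \<le> a} = a"
  proof cases
    case 1
    have "prob {t \<in> space M. F (w t) \<le> 0} \<le> e" if "0 < e" "e < 1" for e
    proof -
      have "prob {t \<in> space M. F (w t) \<le> 0} \<le> prob {t \<in> space M. F (w t) \<le> e}"
        by (intro finite_measure_mono) (use that in auto)
      then show ?thesis by (simp add: mid[OF that])
    qed
    then have "prob {t \<in> space M. F (w t) \<le> 0} \<le> 0"
      by (intro dense_ge_bounded[of 0 1]) auto
    with 1 show ?thesis by (simp add: measure_le_0_iff)
  next
    case 3
    then have "{t \<in> space M. F (w t) \<le> a} = space M" by (auto simp: F_def)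
    with 3 show ?thesis by (simp add: prob_space)
  qed (rule mid)
qed

end

text \<open>With every set as a simplex the condition on faces is vacuous, which leaves all
  probability vectors, of finite or infinite support.\<close>

abbreviation prob_simplex :: "'s set \<Rightarrow> ('s \<Rightarrow> real) set" where
  "prob_simplex S \<equiv> realization_completion_set S UNIV"

lemma simplexD:
  assumes "\<beta> \<in> prob_simplex S"
  shows "(\<beta> has_sum 1) S" "\<beta> summable_on S" "s \<in> S \<Longrightarrow> 0 \<le> \<beta> s" "\<beta> \<in> extensional S"
  using assms by (auto simp: realization_completion_set_def PiE_iff summable_on_def)

lemma l1_summable_simplex:
  "\<alpha> \<in> prob_simplex S \<Longrightarrow> \<beta> \<in> prob_simplex S \<Longrightarrow> (\<lambda>s. \<bar>\<alpha> s - \<beta> s\<bar>) summable_on S"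
  by (rule l1_summable) (auto dest: simplexD)

lemma infsum_diff_le_l1_dist:
  assumes "\<alpha> \<in> prob_simplex S" "\<beta> \<in> prob_simplex S" "T \<subseteq> S"
  shows "\<bar>infsum \<alpha> T - infsum \<beta> T\<bar> \<le> l1_dist S \<alpha> \<beta>"
proof -
  have s: "\<alpha> summable_on T" "\<beta> summable_on T" "(\<lambda>s. \<bar>\<alpha> s - \<beta> s\<bar>) summable_on T"
    using assms(3) simplexD(2)[OF assms(1)] simplexD(2)[OF assms(2)] l1_summable_simplex[OF assms(1,2)]
    by (blast intro: summable_on_subset_banach)+
  have "infsum \<alpha> T - infsum \<beta> T = (\<Sum>\<^sub>\<infinity>s\<in>T. \<alpha> s - \<beta> s)"
    using infsum_add[OF s(1) s(2)[THEN summable_on_uminus[THEN iffD2]]] by (simp add: infsum_uminus)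
  also have "\<bar>\<dots>\<bar> \<le> (\<Sum>\<^sub>\<infinity>s\<in>T. \<bar>\<alpha> s - \<beta> s\<bar>)"
    using norm_infsum_bound[of "\<lambda>s. \<alpha> s - \<beta> s" T] s(3) by simp
  also have "\<dots> \<le> l1_dist S \<alpha> \<beta>"
    unfolding l1_dist_def
    by (rule infsum_mono2) (use s(3) l1_summable_simplex[OF assms(1,2)] assms(3) in auto)
  finally show ?thesis .
qed


section \<open>Transport along ranks\<close>

context prob_space
begin

text \<open>Required at every point rather than almost everywhere, so that the range is countable
  and ranks can be compared pointwise.\<close>

definition positive_fibres :: "'s set \<Rightarrow> ('a \<Rightarrow> 's) \<Rightarrow> bool" where
  "positive_fibres S f \<longleftrightarrow> f \<in> M \<rightarrow>\<^sub>M count_space S \<and> (\<forall>t\<in>space M. mass f (f t) > 0)"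

text \<open>Every value is an atom of the distribution of \<open>f\<close>, and a probability
  measure has only countably many atoms.\<close>

lemma positive_fibres_countable_range:
  assumes "positive_fibres S f"
  shows "countable (f ` space M)"
proof -
  have f: "f \<in> M \<rightarrow>\<^sub>M count_space S" using assms by (simp add: positive_fibres_def)
  interpret D: prob_space "distr M (count_space S) f" by (rule prob_space_distr[OF f])
  have "f t \<in> {s. measure (distr M (count_space S) f) {s} \<noteq> 0}" if t: "t \<in> space M" for t
  proof -
    have "f t \<in> S" using measurable_space[OF f t] by simp
    then have "measure (distr M (count_space S) f) {f t} = mass f (f t)"
      by (subst measure_distr[OF f]) (auto simp: mass_def intro!: arg_cong[where f = prob])
    moreover have "mass f (f t) > 0" using assms t by (simp add: positive_fibres_def)
    ultimately show ?thesis by simp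
  qed
  then show ?thesis by (intro countable_subset[OF _ D.countable_support]) auto
qed

end

context uniform_label
begin

lemma label_interval:
  assumes "0 \<le> a" "a \<le> b" "b \<le> 1"
  shows "prob {x \<in> space M. a < u x \<and> u x \<le> b} = b - a"
proof -
  have "prob {x \<in> space M. u x \<le> b}
      = prob ({x \<in> space M. u x \<le> a} \<union> {x \<in> space M. a < u x \<and> u x \<le> b})"
    by (rule arg_cong[where f = prob]) (use assms in auto)
  also have "\<dots> = prob {x \<in> space M. u x \<le> a} + prob {x \<in> space M. a < u x \<and> u x \<le> b}"
    by (rule finite_measure_Union) auto
  finally show ?thesis using assms by (simp add: label_uniform)
qed

lemma label_no_atom: "prob {x \<in> space M. u x = c} = 0"
proof (cases "0 < c \<and> c < 1")
  case True
  have "prob {x \<in> space M. u x = c} \<le> e" if "0 < e" "e < c" for e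
  proof -
    have "prob {x \<in> space M. u x = c} \<le> prob {x \<in> space M. c - e < u x \<and> u x \<le> c}"
      by (intro finite_measure_mono) (use that in auto)
    then show ?thesis using label_interval[of "c - e" c] that True by simp
  qed
  then have "prob {x \<in> space M. u x = c} \<le> 0"
    using True by (intro dense_ge_bounded[of 0 c]) auto
  then show ?thesis by (simp add: measure_le_0_iff)
next
  case False
  then have "{x \<in> space M. u x = c} = {}" using label_range by auto
  then show ?thesis by (metis measure_empty)
qed

end

locale ordered_labels = uniform_label M u A
  for M :: "'w measure" and u :: "'w \<Rightarrow> real" and A :: "'w set" +
  fixes S :: "'s set" and lt :: "'s \<Rightarrow> 's \<Rightarrow> bool"
  assumes lt_irrefl: "\<not> lt s s"
    and lt_trans: "lt s s' \<Longrightarrow> lt s' s'' \<Longrightarrow> lt s s''"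
    and lt_total: "s \<noteq> s' \<Longrightarrow> lt s s' \<or> lt s' s"
begin

definition rank :: "('w \<Rightarrow> 's) \<Rightarrow> 'w \<Rightarrow> real" where
  "rank f t = prob {x \<in> space M. lt (f x) (f t) \<or> f x = f t \<and> u x \<le> u t}"

lemma rank_events:
  assumes "f \<in> M \<rightarrow>\<^sub>M count_space S"
  shows "{x \<in> space M. P (f x) \<or> f x = s \<and> u x \<le> c} \<in> events"
proof -
  have "{x \<in> space M. P (f x) \<or> f x = s \<and> u x \<le> c}
      = {x \<in> space M. P (f x)} \<union> ({x \<in> space M. f x = s} \<inter> {x \<in> space M. u x \<le> c})" by auto
  also have "\<dots> \<in> events"
    by (intro sets.Un sets.Int sets_Collect_discrete[OF assms]) measurable
  finally show ?thesis .
qed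

text \<open>The lexicographic order of the pairs \<open>(f t, u t)\<close> is realized by the real random variable
  \<open>w\<close>, so that \<open>rank f\<close> is its probability integral transform.\<close>

lemma
  assumes "positive_fibres S f"
  shows rank_measurable: "rank f \<in> borel_measurable M"
    and rank_uniform: "0 \<le> a \<Longrightarrow> a \<le> 1 \<Longrightarrow> prob {t \<in> space M. rank f t \<le> a} = a"
proof -
  have f: "f \<in> M \<rightarrow>\<^sub>M count_space S" and pos: "\<And>t. t \<in> space M \<Longrightarrow> mass f (f t) > 0"
    using assms by (auto simp: positive_fibres_def)
  define C where "C s = prob {x \<in> space M. lt (f x) s}" for s
  \<comment> \<open>The points with value \<open>s\<close> are sent into the interval of length
    \<open>mass f s\<close> that starts at \<open>C s\<close>, ordered there by the label. Positive
    masses and labels strictly inside the unit interval separate different values.\<close>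
  define w where "w t = C (f t) + mass f (f t) * u t" for t
  have g: "(\<lambda>t. g (f t)) \<in> borel_measurable M" for g :: "'s \<Rightarrow> real"
    by (rule measurable_compose[OF f]) simp
  have w: "w \<in> borel_measurable M"
    unfolding w_def using g[of C] g[of "mass f"] by measurable
  have step: "C s + mass f s \<le> C s'" if "lt s s'" for s s'
  proof -
    have "C s + mass f s = prob ({x \<in> space M. lt (f x) s} \<union> {x \<in> space M. f x = s})"
      unfolding C_def mass_def
      by (rule finite_measure_Union[symmetric]) (auto simp: lt_irrefl intro!: sets_Collect_discrete[OF f])
    also have "\<dots> \<le> C s'"
      unfolding C_def
      by (intro finite_measure_mono sets_Collect_discrete[OF f]) (use that lt_trans in blast)
    finally show ?thesis .
  qed
  have less: "w x < w t" if "x \<in> space M" "t \<in> space M" "lt (f x) (f t)" for x t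
  proof -
    have "w x < C (f x) + mass f (f x)"
      using pos[OF that(1)] label_range[OF that(1)] by (simp add: w_def)
    also have "\<dots> \<le> C (f t)" by (rule step[OF that(3)])
    also have "\<dots> < w t" using pos[OF that(2)] label_range[OF that(2)] by (simp add: w_def)
    finally show ?thesis .
  qed
  have lex: "w x \<le> w t \<longleftrightarrow> lt (f x) (f t) \<or> f x = f t \<and> u x \<le> u t"
    if xt: "x \<in> space M" "t \<in> space M" for x t
  proof -
    consider "lt (f x) (f t)" | "f x = f t" | "lt (f t) (f x)" using lt_total by blast
    then show ?thesis
    proof cases
      case 1
      then show ?thesis using less[OF xt] by auto
    next
      case 2
      then show ?thesis using pos[OF xt(2)] by (simp add: w_def lt_irrefl)
    next
      case 3
      then have "\<not> lt (f x) (f t)" "f x \<noteq> f t" using lt_trans lt_irrefl by metis+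
      with 3 show ?thesis using less[OF xt(2,1)] by auto
    qed
  qed
  \<comment> \<open>Points with equal \<open>w\<close> have equal labels, so a level set of
    \<open>w\<close> lies in a level set of \<open>u\<close>.\<close>
  have no_atom: "prob {x \<in> space M. w x = y} = 0" for y
  proof (cases "{x \<in> space M. w x = y} = {}")
    case False
    then obtain x0 where x0: "x0 \<in> space M" "w x0 = y" by auto
    have "u x = u x0" if x: "x \<in> space M" "w x = y" for x
      using lex[OF x(1) x0(1)] lex[OF x0(1) x(1)] x x0 lt_trans lt_irrefl
      by (metis order.refl order.antisym)
    then have "prob {x \<in> space M. w x = y} \<le> prob {x \<in> space M. u x = u x0}"
      by (intro finite_measure_mono) auto
    then show ?thesis by (simp add: label_no_atom measure_le_0_iff)
  qed (metis measure_empty)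
  have rank: "rank f t = prob {x \<in> space M. w x \<le> w t}" if "t \<in> space M" for t
    unfolding rank_def by (rule arg_cong[where f = prob]) (use lex that in auto)
  note pit = probability_integral_transform[OF w no_atom]
  have "(\<lambda>t. prob {x \<in> space M. w x \<le> w t}) \<in> borel_measurable M"
    by (rule measurable_compose[OF w pit(1)])
  then show "rank f \<in> borel_measurable M" by (subst measurable_cong[OF rank])
  show "prob {t \<in> space M. rank f t \<le> a} = a" if "0 \<le> a" "a \<le> 1"
    using pit(2)[OF that] by (simp add: rank cong: conj_cong)
qed

text \<open>The ends are clipped to the unit interval because the margins around the ends of a slot,
  to which the bound is applied later, may stick out of it.\<close>

lemma rank_interval:
  assumes "positive_fibres S f" "a \<le> b"
  shows "prob {t \<in> space M. a < rank f t \<and> rank f t \<le> b} = max 0 (min 1 b) - max 0 (min 1 a)"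
proof -
  note [measurable] = rank_measurable[OF assms(1)]
  have clip: "prob {t \<in> space M. rank f t \<le> c} = max 0 (min 1 c)" for c
  proof -
    consider "c < 0" | "0 \<le> c" "c \<le> 1" | "c > 1" by linarith
    then show ?thesis
    proof cases
      case 1
      then have empty: "{t \<in> space M. rank f t \<le> c} = {}"
        by (auto simp: rank_def not_le intro: less_le_trans)
      show ?thesis unfolding empty using 1 by simp
    next
      case 3
      then have full: "{t \<in> space M. rank f t \<le> c} = space M"
        by (auto simp: rank_def intro: order_trans[OF prob_le_1])
      show ?thesis unfolding full using 3 by (simp add: prob_space)
    qed (use rank_uniform[OF assms(1)] in simp)
  qed
  have "prob {t \<in> space M. rank f t \<le> b}
      = prob ({t \<in> space M. rank f t \<le> a} \<union> {t \<in> space M. a < rank f t \<and> rank f t \<le> b})"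
    by (rule arg_cong[where f = prob]) (use assms in auto)
  also have "\<dots> = prob {t \<in> space M. rank f t \<le> a} + prob {t \<in> space M. a < rank f t \<and> rank f t \<le> b}"
    by (rule finite_measure_Union) auto
  finally show ?thesis by (simp add: clip)
qed

lemma rank_interval_le:
  assumes "positive_fibres S f" "a \<le> b"
  shows "prob {t \<in> space M. a < rank f t \<and> rank f t \<le> b} \<le> b - a"
  unfolding rank_interval[OF assms] using assms(2) by (auto simp: max_def min_def)

lemma rank_no_atom:
  assumes "positive_fibres S f"
  shows "prob {t \<in> space M. rank f t = a} = 0"
proof -
  note [measurable] = rank_measurable[OF assms]
  have "prob {t \<in> space M. rank f t = a} \<le> 0 + e" if "0 < e" for e
  proof -
    have "prob {t \<in> space M. rank f t = a} \<le> prob {t \<in> space M. a - e < rank f t \<and> rank f t \<le> a}"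
      by (intro finite_measure_mono) (use that in auto)
    then show ?thesis using rank_interval_le[OF assms, of "a - e" a] that by simp
  qed
  then have "prob {t \<in> space M. rank f t = a} \<le> 0" by (rule field_le_epsilon)
  then show ?thesis by (simp add: measure_le_0_iff)
qed

text \<open>Both ranks use the same label, so the two sets being measured agree at every
  \<open>x\<close> with \<open>f x = g x\<close>.\<close>

lemma rank_diff_le:
  assumes "f \<in> M \<rightarrow>\<^sub>M count_space S" "g \<in> M \<rightarrow>\<^sub>M count_space S" "countable (f ` space M)" "f t = g t"
  shows "rank f t \<le> rank g t + prob {x \<in> space M. f x \<noteq> g x}"
proof -
  have "rank f t \<le> prob ({x \<in> space M. lt (g x) (g t) \<or> g x = g t \<and> u x \<le> u t} \<union> {x \<in> space M. f x \<noteq> g x})"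
    unfolding rank_def
    by (intro finite_measure_mono sets.Un rank_events[OF assms(2)] events_pred2[OF assms(1-3)])
      (use assms(4) in auto)
  also have "\<dots> \<le> rank g t + prob {x \<in> space M. f x \<noteq> g x}"
    unfolding rank_def by (intro measure_Un_le rank_events[OF assms(2)] events_pred2[OF assms(1-3)])
  finally show ?thesis .
qed

section \<open>Slots of a probability vector and transport\<close>

definition cum :: "('s \<Rightarrow> real) \<Rightarrow> 's \<Rightarrow> real" where
  "cum \<beta> s = infsum \<beta> {s' \<in> S. lt s' s}"

text \<open>As a sum over a subset of \<open>S\<close>, the right end of a slot depends on the
  vector with the same Lipschitz constant 1 as the left end.\<close>

lemma cum_add:
  assumes "\<beta> \<in> prob_simplex S" "s \<in> S"
  shows "cum \<beta> s + \<beta> s = infsum \<beta> (insert s {s' \<in> S. lt s' s})"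
proof -
  have "\<beta> summable_on {s' \<in> S. lt s' s}"
    by (rule summable_on_subset_banach[OF simplexD(2)[OF assms(1)]]) auto
  then show ?thesis unfolding cum_def by (subst infsum_insert) (auto simp: lt_irrefl)
qed

lemma infsum_simplex_mono:
  assumes "\<beta> \<in> prob_simplex S" "T \<subseteq> T'" "T' \<subseteq> S"
  shows "infsum \<beta> T \<le> infsum \<beta> T'"
proof (rule infsum_mono2)
  show "\<beta> summable_on T" "\<beta> summable_on T'"
    using assms by (auto intro: summable_on_subset_banach[OF simplexD(2)[OF assms(1)]])
qed (use assms simplexD(3)[OF assms(1)] in auto)

lemma cum_step:
  assumes "\<beta> \<in> prob_simplex S" "s \<in> S" "lt s s'"
  shows "cum \<beta> s + \<beta> s \<le> cum \<beta> s'"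
  unfolding cum_add[OF assms(1,2)] unfolding cum_def
  by (rule infsum_simplex_mono[OF assms(1)]) (use assms lt_trans in auto)

lemma cum_bounds:
  assumes "\<beta> \<in> prob_simplex S" "s \<in> S"
  shows "0 \<le> cum \<beta> s" "cum \<beta> s + \<beta> s \<le> 1"
proof -
  show "0 \<le> cum \<beta> s"
    unfolding cum_def by (rule infsum_nonneg) (use simplexD(3)[OF assms(1)] in auto)
  have "cum \<beta> s + \<beta> s \<le> infsum \<beta> S"
    unfolding cum_add[OF assms] by (rule infsum_simplex_mono[OF assms(1)]) (use assms(2) in auto)
  also have "infsum \<beta> S = 1" by (rule infsumI[OF simplexD(1)[OF assms(1)]])
  finally show "cum \<beta> s + \<beta> s \<le> 1" .
qed

lemma cum_diff_le:
  assumes "\<beta> \<in> prob_simplex S" "\<gamma> \<in> prob_simplex S" "s \<in> S"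
  shows "\<bar>cum \<beta> s - cum \<gamma> s\<bar> \<le> l1_dist S \<beta> \<gamma>"
    and "\<bar>(cum \<beta> s + \<beta> s) - (cum \<gamma> s + \<gamma> s)\<bar> \<le> l1_dist S \<beta> \<gamma>"
  unfolding cum_add[OF assms(1,3)] cum_add[OF assms(2,3)] unfolding cum_def
  by (rule infsum_diff_le_l1_dist[OF assms(1,2)]; use assms(3) in auto)+

text \<open>Half-open, so that different values have disjoint slots and a value of weight zero has
  none.\<close>

definition slot :: "('s \<Rightarrow> real) \<Rightarrow> 's \<Rightarrow> real set" where
  "slot \<beta> s = {cum \<beta> s<..cum \<beta> s + \<beta> s}"

lemma slot_unique:
  assumes "\<beta> \<in> prob_simplex S" "s \<in> S" "s' \<in> S" "r \<in> slot \<beta> s" "r \<in> slot \<beta> s'"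
  shows "s = s'"
proof (rule ccontr)
  assume "s \<noteq> s'"
  then consider "lt s s'" | "lt s' s" using lt_total by blast
  then show False
    using cum_step[OF assms(1,2), of s'] cum_step[OF assms(1,3), of s] assms(4,5)
    by cases (auto simp: slot_def)
qed

text \<open>The slots have total length 1, so a rank misses all of them with probability zero. The
  default \<open>f t\<close> keeps the values in \<open>S\<close> and the range countable.\<close>

definition transport :: "('w \<Rightarrow> 's) \<Rightarrow> ('s \<Rightarrow> real) \<Rightarrow> 'w \<Rightarrow> 's" where
  "transport f \<beta> t =
     (if \<exists>s\<in>S. rank f t \<in> slot \<beta> s then THE s. s \<in> S \<and> rank f t \<in> slot \<beta> s else f t)"

lemma transport_eq:
  assumes "\<beta> \<in> prob_simplex S" "s \<in> S" "rank f t \<in> slot \<beta> s"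
  shows "transport f \<beta> t = s"
  unfolding transport_def using assms slot_unique[OF assms(1)]
  by (auto intro!: the_equality)

text \<open>Only values of nonzero weight have a nonempty slot, and a summable family has countably
  many of them; all other values taken are values of \<open>f\<close>.\<close>

lemma
  assumes f: "positive_fibres S f" and \<beta>: "\<beta> \<in> prob_simplex S"
  shows transport_countable_range: "countable (transport f \<beta> ` space M)"
    and transport_measurable: "transport f \<beta> \<in> M \<rightarrow>\<^sub>M count_space S"
proof -
  let ?B = "{s \<in> S. \<beta> s \<noteq> 0}"
  note [measurable] = rank_measurable[OF f]
  have fm: "f \<in> M \<rightarrow>\<^sub>M count_space S" using f by (simp add: positive_fibres_def)
  have B: "countable ?B" by (rule summable_countable_real[OF simplexD(2)[OF \<beta>]])
  have slotB: "s \<in> ?B" if "s \<in> S" "r \<in> slot \<beta> s" for r s using that by (auto simp: slot_def)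
  have cases: "(\<exists>s\<in>?B. rank f t \<in> slot \<beta> s \<and> transport f \<beta> t = s)
      \<or> (\<forall>s\<in>?B. rank f t \<notin> slot \<beta> s) \<and> transport f \<beta> t = f t" for t
  proof (cases "\<exists>s\<in>S. rank f t \<in> slot \<beta> s")
    case True
    then obtain s where s: "s \<in> S" "rank f t \<in> slot \<beta> s" by blast
    then show ?thesis using slotB[OF s] transport_eq[OF \<beta> s] by blast
  next
    case False
    then have "transport f \<beta> t = f t" by (simp add: transport_def)
    with False show ?thesis by blast
  qed
  have range: "transport f \<beta> ` space M \<subseteq> ?B \<union> f ` space M" using cases by blast
  then show C: "countable (transport f \<beta> ` space M)"
    by (rule countable_subset) (use B positive_fibres_countable_range[OF f] in simp)
  show "transport f \<beta> \<in> M \<rightarrow>\<^sub>M count_space S"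
  proof (rule measurable_count_space_countable_range[OF _ C])
    show "transport f \<beta> \<in> space M \<rightarrow> S" using range measurable_space[OF fm] by auto
    fix s
    have slot_ev: "{t \<in> space M. rank f t \<in> slot \<beta> s'} \<in> events" for s'
      unfolding slot_def by measurable
    have iff: "transport f \<beta> t = s \<longleftrightarrow>
        s \<in> ?B \<and> rank f t \<in> slot \<beta> s \<or> f t = s \<and> (\<forall>s'\<in>?B. rank f t \<notin> slot \<beta> s')" for t
    proof -
      from cases[of t] show ?thesis
      proof (elim disjE bexE conjE)
        fix s0 assume s0: "s0 \<in> ?B" "rank f t \<in> slot \<beta> s0" "transport f \<beta> t = s0"
        then have "s = s0" if "s \<in> ?B" "rank f t \<in> slot \<beta> s"
          using that by (intro slot_unique[OF \<beta>]) auto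
        with s0 show ?thesis by auto
      qed auto
    qed
    have "{t \<in> space M. transport f \<beta> t = s}
        = (if s \<in> ?B then {t \<in> space M. rank f t \<in> slot \<beta> s} else {})
        \<union> ({t \<in> space M. f t = s} - (\<Union>s'\<in>?B. {t \<in> space M. rank f t \<in> slot \<beta> s'}))"
      by (auto simp: iff split: if_splits)
    also have "\<dots> \<in> events"
      using slot_ev by (intro sets.Un sets.Diff sets.countable_UN'' B sets_Collect_discrete[OF fm]) auto
    finally show "{t \<in> space M. transport f \<beta> t = s} \<in> events" .
  qed
qed

lemma slot_prob:
  assumes "positive_fibres S f" "\<beta> \<in> prob_simplex S" "s \<in> S"
  shows "prob {t \<in> space M. rank f t \<in> slot \<beta> s} = \<beta> s"
  using rank_interval[OF assms(1), of "cum \<beta> s" "cum \<beta> s + \<beta> s"] cum_bounds[OF assms(2,3)]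
    simplexD(3)[OF assms(2,3)]
  by (simp add: slot_def)

text \<open>Points with rank in the slot of \<open>s\<close> receive the value \<open>s\<close>,
  which gives one inequality for every \<open>s\<close>. Both families sum to 1, so equality holds
  throughout.\<close>

lemma mass_transport:
  assumes f: "positive_fibres S f" and \<beta>: "\<beta> \<in> prob_simplex S" and s: "s \<in> S"
  shows "mass (transport f \<beta>) s = \<beta> s"
proof -
  note m = transport_measurable[OF f \<beta>] and c = transport_countable_range[OF f \<beta>]
  have le: "\<beta> s \<le> mass (transport f \<beta>) s" if "s \<in> S" for s
    unfolding slot_prob[OF f \<beta> that, symmetric] mass_def
    by (intro finite_measure_mono sets_Collect_discrete[OF m]) (use transport_eq[OF \<beta> that] in auto)
  have "{x \<in> space M. transport f \<beta> x \<in> S} = space M" using measurable_space[OF m] by auto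
  then have "(mass (transport f \<beta>) has_sum 1) S"
    using has_sum_mass[OF m c, of S] by (simp add: prob_space)
  from has_sum_add[OF this has_sum_uminusI[OF simplexD(1)[OF \<beta>]]]
  have "((\<lambda>s. mass (transport f \<beta>) s - \<beta> s) has_sum 0) S" by simp
  then have "mass (transport f \<beta>) s - \<beta> s = 0"
    using nonneg_infsum_le_0D[of "\<lambda>s. mass (transport f \<beta>) s - \<beta> s" S s] le s
    by (auto simp: infsumI summable_on_def)
  then show ?thesis by simp
qed

text \<open>The rank of a point with value \<open>s\<close> lies between the probability of the
  values below \<open>s\<close> and that plus \<open>mass f s\<close>, which are the ends of the
  slot of \<open>s\<close>. Only the excluded left ends can fail: countably many ranks, each of
  probability zero.\<close>

lemma transport_own_mass:
  assumes f: "positive_fibres S f" and \<beta>: "\<beta> \<in> prob_simplex S" and eq: "\<And>s. s \<in> S \<Longrightarrow> \<beta> s = mass f s"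
  shows "AE t in M. transport f \<beta> t = f t"
proof -
  note [measurable] = rank_measurable[OF f]
  have fm: "f \<in> M \<rightarrow>\<^sub>M count_space S" using f by (simp add: positive_fibres_def)
  note C = positive_fibres_countable_range[OF f]
  have "(\<Union>s\<in>f ` space M. {t \<in> space M. rank f t = cum \<beta> s}) \<in> null_sets M"
    by (intro null_sets_UN' C null_setsI) (simp_all add: emeasure_eq_measure rank_no_atom[OF f])
  from AE_not_in[OF this] show ?thesis
  proof (rule AE_mp, intro AE_I2 impI)
    fix t assume t: "t \<in> space M" and "t \<notin> (\<Union>s\<in>f ` space M. {t \<in> space M. rank f t = cum \<beta> s})"
    then have ne: "rank f t \<noteq> cum \<beta> (f t)" by auto
    have ftS: "f t \<in> S" using measurable_space[OF fm t] by simp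
    have cum: "cum \<beta> (f t) = prob {x \<in> space M. lt (f x) (f t)}"
    proof -
      have "cum \<beta> (f t) = infsum (mass f) {s \<in> S. lt s (f t)}"
        unfolding cum_def by (rule infsum_cong) (simp add: eq)
      also have "\<dots> = prob {x \<in> space M. f x \<in> {s \<in> S. lt s (f t)}}"
        by (rule infsumI[OF has_sum_mass[OF fm C]])
      also have "\<dots> = prob {x \<in> space M. lt (f x) (f t)}"
        by (rule arg_cong[where f = prob]) (use measurable_space[OF fm] in auto)
      finally show ?thesis .
    qed
    have "cum \<beta> (f t) \<le> rank f t"
      unfolding cum rank_def by (intro finite_measure_mono rank_events[OF fm]) auto
    moreover have "rank f t \<le> prob ({x \<in> space M. lt (f x) (f t)} \<union> {x \<in> space M. f x = f t})"
      unfolding rank_def by (intro finite_measure_mono sets.Un sets_Collect_discrete[OF fm]) auto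
    moreover have "\<dots> \<le> cum \<beta> (f t) + \<beta> (f t)"
      unfolding cum eq[OF ftS] mass_def by (intro measure_Un_le sets_Collect_discrete[OF fm])
    ultimately have "rank f t \<in> slot \<beta> (f t)" using ne by (simp add: slot_def)
    then show "transport f \<beta> t = f t" by (rule transport_eq[OF \<beta> ftS])
  qed
qed

text \<open>Each slot contributes an error at its ends, so only finitely many slots can be
  controlled; the others cost \<open>1 - sum \<beta> T\<close>. With \<open>d\<close> and
  \<open>e\<close> the two distances, a slot in \<open>T\<close> costs \<open>d\<close> for
  disagreement of \<open>f\<close> and \<open>g\<close> and \<open>d + e\<close> at either
  end.\<close>

lemma transport_diff_le:
  assumes f: "positive_fibres S f" and g: "positive_fibres S g"
    and \<beta>: "\<beta> \<in> prob_simplex S" and \<gamma>: "\<gamma> \<in> prob_simplex S" and T: "finite T" "T \<subseteq> S"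
  shows "prob {t \<in> space M. transport f \<beta> t \<noteq> transport g \<gamma> t}
    \<le> (1 - sum \<beta> T) + card T * (3 * prob {t \<in> space M. f t \<noteq> g t} + 2 * l1_dist S \<beta> \<gamma>)"
proof -
  note [measurable] = rank_measurable[OF f]
  have fm: "f \<in> M \<rightarrow>\<^sub>M count_space S" and gm: "g \<in> M \<rightarrow>\<^sub>M count_space S"
    using f g by (simp_all add: positive_fibres_def)
  note C = positive_fibres_countable_range[OF f]
  define d where "d = prob {t \<in> space M. f t \<noteq> g t}"
  define e where "e = l1_dist S \<beta> \<gamma>"
  have e0: "0 \<le> e" unfolding e_def l1_dist_def by (rule infsum_nonneg) auto
  have d0: "0 \<le> d" by (simp add: d_def)
  note tm = transport_measurable[OF f \<beta>] transport_measurable[OF g \<gamma>] transport_countable_range[OF f \<beta>]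
  have slot_ev: "{t \<in> space M. rank f t \<in> slot \<beta> s} \<in> events" for s
    unfolding slot_def by measurable
  define E where "E s = {t \<in> space M. rank f t \<in> slot \<beta> s} \<inter> {t \<in> space M. transport g \<gamma> t \<noteq> s}" for s
  have E_ev: "E s \<in> events" for s
    unfolding E_def by (intro sets.Int slot_ev sets_Collect_discrete[OF tm(2)])
  have neq_ev: "{t \<in> space M. f t \<noteq> g t} \<in> events" by (rule events_pred2[OF fm gm C])
  have E_le: "prob (E s) \<le> 3 * d + 2 * e" if s: "s \<in> S" for s
  proof -
    let ?a = "cum \<beta> s" and ?b = "cum \<beta> s + \<beta> s"
    \<comment> \<open>Where \<open>f\<close> and \<open>g\<close> agree the ranks differ by at most
      \<open>d\<close>, and the ends of the slots by at most \<open>e\<close>. So a rank farther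
      than \<open>d + e\<close> from both ends remains in the corresponding slot.\<close>
    let ?L = "{t \<in> space M. ?a < rank f t \<and> rank f t \<le> ?a + (d + e)}"
    let ?R = "{t \<in> space M. ?b - (d + e) < rank f t \<and> rank f t \<le> ?b}"
    have "E s \<subseteq> {t \<in> space M. f t \<noteq> g t} \<union> (?L \<union> ?R)"
    proof
      fix t assume t: "t \<in> E s"
      then have tM: "t \<in> space M" and "rank f t \<in> slot \<beta> s" and "rank g t \<notin> slot \<gamma> s"
        using transport_eq[OF \<gamma> s] by (auto simp: E_def)
      moreover have "\<bar>rank f t - rank g t\<bar> \<le> d" if "f t = g t"
        using rank_diff_le[OF fm gm C that]
          rank_diff_le[OF gm fm positive_fibres_countable_range[OF g] that[symmetric]]
        by (simp add: d_def eq_commute abs_le_iff)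
      ultimately show "t \<in> {t \<in> space M. f t \<noteq> g t} \<union> (?L \<union> ?R)"
        using cum_diff_le[OF \<beta> \<gamma> s] by (auto simp: slot_def e_def)
    qed
    then have "prob (E s) \<le> prob ({t \<in> space M. f t \<noteq> g t} \<union> (?L \<union> ?R))"
      by (intro finite_measure_mono sets.Un neq_ev) measurable
    also have "\<dots> \<le> d + prob (?L \<union> ?R)"
      unfolding d_def by (intro measure_Un_le neq_ev) measurable
    also have "prob (?L \<union> ?R) \<le> prob ?L + prob ?R" by (intro measure_Un_le) measurable
    also have "prob ?L \<le> d + e" using rank_interval_le[OF f, of ?a "?a + (d + e)"] d0 e0 by simp
    also have "prob ?R \<le> d + e" using rank_interval_le[OF f, of "?b - (d + e)" ?b] d0 e0 by simp
    finally show ?thesis by simp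
  qed
  let ?G = "\<Union>s\<in>T. {t \<in> space M. rank f t \<in> slot \<beta> s}"
  have G_ev: "?G \<in> events" using T(1) by (intro sets.finite_UN slot_ev) auto
  have "disjoint_family_on (\<lambda>s. {t \<in> space M. rank f t \<in> slot \<beta> s}) T"
    unfolding disjoint_family_on_def using slot_unique[OF \<beta>] T(2) by blast
  then have "prob ?G = (\<Sum>s\<in>T. prob {t \<in> space M. rank f t \<in> slot \<beta> s})"
    using T(1) slot_ev by (intro finite_measure_finite_Union) auto
  also have "\<dots> = sum \<beta> T" by (rule sum.cong) (use T slot_prob[OF f \<beta>] in auto)
  finally have "prob (space M - ?G) = 1 - sum \<beta> T" by (simp add: prob_compl[OF G_ev])
  moreover have "prob {t \<in> space M. transport f \<beta> t \<noteq> transport g \<gamma> t} \<le> prob ((space M - ?G) \<union> (\<Union>s\<in>T. E s))"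
  proof (rule finite_measure_mono)
    show "{t \<in> space M. transport f \<beta> t \<noteq> transport g \<gamma> t} \<subseteq> (space M - ?G) \<union> (\<Union>s\<in>T. E s)"
      using transport_eq[OF \<beta>] T(2) by (auto simp: E_def)
    show "(space M - ?G) \<union> (\<Union>s\<in>T. E s) \<in> events"
      using T(1) G_ev E_ev by (intro sets.Un sets.Diff[OF sets.top G_ev] sets.finite_UN) auto
  qed
  moreover have "\<dots> \<le> prob (space M - ?G) + prob (\<Union>s\<in>T. E s)"
    using T(1) E_ev by (intro measure_Un_le sets.Diff[OF sets.top G_ev] sets.finite_UN) auto
  moreover have "prob (\<Union>s\<in>T. E s) \<le> (\<Sum>s\<in>T. prob (E s))"
    using T(1) E_ev by (intro finite_measure_subadditive_finite) auto
  moreover have "\<dots> \<le> (\<Sum>s\<in>T. 3 * d + 2 * e)" using T(2) by (intro sum_mono E_le) auto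
  moreover have "\<dots> = card T * (3 * d + 2 * e)" by simp
  ultimately show ?thesis unfolding d_def e_def by linarith
qed

end


section \<open>Passing to classes\<close>

context ordered_labels
begin

text \<open>Values of probability zero are replaced by one fixed value of positive probability;
  almost no point is affected.\<close>

lemma positive_representative:
  assumes "F \<in> L_space M S"
  obtains f where "f \<in> F" "positive_fibres S f"
proof -
  obtain f where f: "f \<in> M \<rightarrow>\<^sub>M count_space S" and F: "F = ae_rel M S `` {f}"
    using assms unfolding L_space_def by (rule quotientE)
  have pos: "AE t in M. mass f (f t) > 0"
    using AE_positive_fibre[OF f] by (simp add: mass_def)
  then have "\<exists>t\<in>space M. mass f (f t) > 0"
  proof (rule contrapos_pp)
    assume "\<not> (\<exists>t\<in>space M. mass f (f t) > 0)"
    then have "{t \<in> space M. mass f (f t) > 0} = {}" by blast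
    moreover have "{t \<in> space M. mass f (f t) > 0} \<in> events" by (rule sets_Collect_discrete[OF f])
    ultimately show "\<not> (AE t in M. mass f (f t) > 0)"
      using prob_Collect_eq_1[of "\<lambda>t. mass f (f t) > 0"] by simp
  qed
  then obtain t0 where t0: "t0 \<in> space M" "mass f (f t0) > 0" by blast
  define g where "g s = (if mass f s > 0 then s else f t0)" for s
  have f0: "f t0 \<in> S" using measurable_space[OF f t0(1)] by simp
  have gf: "(\<lambda>t. g (f t)) \<in> M \<rightarrow>\<^sub>M count_space S"
    by (rule measurable_compose[OF f]) (use f0 in \<open>auto simp: g_def\<close>)
  have "mass (\<lambda>t. g (f t)) (g (f t)) > 0" for t
  proof -
    have g: "mass f (g (f t)) > 0" "g (g (f t)) = g (f t)" using t0 by (auto simp: g_def)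
    have "mass f (g (f t)) \<le> mass (\<lambda>t. g (f t)) (g (f t))"
      unfolding mass_def
      by (intro finite_measure_mono sets_Collect_discrete[OF gf]) (use g(2) in auto)
    with g(1) show ?thesis by linarith
  qed
  moreover have "AE t in M. f t = g (f t)"
    using pos by (rule eventually_mono) (simp add: g_def)
  ultimately show thesis
    using f gf by (intro that[of "\<lambda>t. g (f t)"]) (auto simp: positive_fibres_def F ae_rel_def)
qed

text \<open>Unlike the unrestricted choice \<open>ae_rep\<close>, this representative has positive
  fibres, hence a countable range.\<close>

definition rep :: "('w \<Rightarrow> 's) set \<Rightarrow> 'w \<Rightarrow> 's" where
  "rep F = (SOME f. f \<in> F \<and> positive_fibres S f)"

definition cls :: "('w \<Rightarrow> 's) \<Rightarrow> ('w \<Rightarrow> 's) set" where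
  "cls f = ae_rel M S `` {f}"

lemma rep:
  assumes "F \<in> L_space M S"
  shows "rep F \<in> F" "positive_fibres S (rep F)" "rep F \<in> M \<rightarrow>\<^sub>M count_space S" "countable (rep F ` space M)"
proof -
  have "\<exists>f. f \<in> F \<and> positive_fibres S f" using positive_representative[OF assms] by metis
  from someI_ex[OF this] show *: "rep F \<in> F" "positive_fibres S (rep F)" by (simp_all add: rep_def)
  then show "rep F \<in> M \<rightarrow>\<^sub>M count_space S" "countable (rep F ` space M)"
    by (simp_all add: positive_fibres_countable_range) (simp add: positive_fibres_def)
qed

lemma cls_in_L_space: "f \<in> M \<rightarrow>\<^sub>M count_space S \<Longrightarrow> cls f \<in> L_space M S"
  unfolding cls_def L_space_def by (rule quotientI)

lemma in_cls: "f \<in> M \<rightarrow>\<^sub>M count_space S \<Longrightarrow> f \<in> cls f"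
  unfolding cls_def by (rule equiv_class_self[OF equiv_ae_rel])

lemma cls_eqI:
  assumes "F \<in> L_space M S" "f \<in> F" "g \<in> M \<rightarrow>\<^sub>M count_space S" "AE t in M. g t = f t"
  shows "cls g = F"
proof -
  obtain h where h: "h \<in> M \<rightarrow>\<^sub>M count_space S" and F: "F = ae_rel M S `` {h}"
    using assms(1) unfolding L_space_def by (rule quotientE)
  have hf: "(h, f) \<in> ae_rel M S" using assms(2) F by simp
  then have "(g, f) \<in> ae_rel M S" using assms(3,4) by (simp add: ae_rel_def)
  then have "(g, h) \<in> ae_rel M S"
    using hf equiv_ae_rel[of M S] by (meson equivE symD transD)
  then show ?thesis
    unfolding cls_def F by (rule equiv_class_eq[OF equiv_ae_rel])
qed

lemma cls_rep: "F \<in> L_space M S \<Longrightarrow> cls (rep F) = F"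
  by (rule cls_eqI) (auto intro: rep)

lemma L_dist_prob:
  assumes "F \<in> L_space M S" "f \<in> F" "G \<in> L_space M S" "g \<in> G" "countable (f ` space M)"
    and "f \<in> M \<rightarrow>\<^sub>M count_space S" "g \<in> M \<rightarrow>\<^sub>M count_space S"
  shows "L_dist M F G = prob {t \<in> space M. f t \<noteq> g t}"
  using events_pred2[OF assms(6,7,5), of "(\<noteq>)"] by (simp add: L_dist_eq[OF assms(1-4)])

lemma L_dist_rep:
  "F \<in> L_space M S \<Longrightarrow> G \<in> L_space M S \<Longrightarrow> L_dist M F G = prob {t \<in> space M. rep F t \<noteq> rep G t}"
  by (intro L_dist_prob rep)

lemma L_dist_cls:
  assumes "f \<in> M \<rightarrow>\<^sub>M count_space S" "g \<in> M \<rightarrow>\<^sub>M count_space S" "countable (f ` space M)"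
  shows "L_dist M (cls f) (cls g) = prob {t \<in> space M. f t \<noteq> g t}"
  using assms by (intro L_dist_prob cls_in_L_space in_cls)

lemma law_mass:
  assumes "F \<in> L_space M S" "f \<in> F"
  shows "law M S F = restrict (mass f) S"
  unfolding law_eq[OF assms] mass_def by (simp add: vimage_def Int_def conj_commute)

section \<open>The metric on classes and the continuity of the law\<close>

lemma Metric_space_L: "Metric_space (L_space M S) (L_dist M)"
proof
  fix F G :: "('w \<Rightarrow> 's) set"
  show "0 \<le> L_dist M F G" by (simp add: L_dist_def)
  show "L_dist M F G = L_dist M G F" unfolding L_dist_def by (metis (no_types, lifting))
  assume F: "F \<in> L_space M S" and G: "G \<in> L_space M S"
  note ev = events_pred2[OF rep(3) rep(3) rep(4)]
  show "L_dist M F G = 0 \<longleftrightarrow> F = G"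
  proof
    assume "L_dist M F G = 0"
    then have "{t \<in> space M. rep F t \<noteq> rep G t} \<in> null_sets M"
      using F G by (intro null_setsI ev) (simp_all add: L_dist_rep emeasure_eq_measure)
    then have "AE t in M. t \<notin> {t \<in> space M. rep F t \<noteq> rep G t}" by (rule AE_not_in)
    then have "AE t in M. rep F t = rep G t" by (rule AE_mp) auto
    then have "cls (rep F) = G" using F G by (intro cls_eqI[of G "rep G"] rep)
    then show "F = G" by (simp add: cls_rep F)
  qed (use F in \<open>simp add: L_dist_rep\<close>)
  fix H :: "('w \<Rightarrow> 's) set" assume H: "H \<in> L_space M S"
  have "L_dist M F H \<le> prob ({t \<in> space M. rep F t \<noteq> rep G t} \<union> {t \<in> space M. rep G t \<noteq> rep H t})"
    unfolding L_dist_rep[OF F H] by (intro finite_measure_mono sets.Un ev F G H) auto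
  also have "\<dots> \<le> L_dist M F G + L_dist M G H"
    unfolding L_dist_rep[OF F G] L_dist_rep[OF G H] by (intro measure_Un_le ev F G H)
  finally show "L_dist M F H \<le> L_dist M F G + L_dist M G H" .
qed

sublocale L: Metric_space "L_space M S" "L_dist M"
  rewrites "Metric_space.mtopology (L_space M S) (L_dist M) = L_topology M S"
  by (rule Metric_space_L) (simp add: L_topology_def)

sublocale P: Metric_space "prob_simplex S" "l1_dist S"
  rewrites "Metric_space.mtopology (prob_simplex S) (l1_dist S) = realization_completion S UNIV"
  by (rule Metric_space_realization_completion) (simp add: realization_completion_def)

lemma law_in_simplex:
  assumes "F \<in> L_space M S"
  shows "law M S F \<in> prob_simplex S"
proof -
  note f = rep[OF assms]
  have "{x \<in> space M. rep F x \<in> S} = space M" using measurable_space[OF f(3)] by auto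
  then have "(mass (rep F) has_sum 1) S"
    using has_sum_mass[OF f(3,4), of S] by (simp add: prob_space)
  then have "(law M S F has_sum 1) S"
    unfolding law_mass[OF assms f(1)] by (simp cong: has_sum_cong)
  then show ?thesis
    unfolding realization_completion_set_def law_mass[OF assms f(1)]
    by (auto simp: mass_def)
qed

lemma l1_dist_law_le:
  assumes F: "F \<in> L_space M S" and G: "G \<in> L_space M S"
  shows "l1_dist S (law M S F) (law M S G) \<le> 2 * L_dist M F G"
  unfolding l1_dist_def
proof (rule infsum_le_finite_sums)
  show "(\<lambda>s. \<bar>law M S F s - law M S G s\<bar>) summable_on S"
    by (intro l1_summable_simplex law_in_simplex F G)
  fix T assume "finite T" "T \<subseteq> S"
  then have "(\<Sum>s\<in>T. \<bar>law M S F s - law M S G s\<bar>) = (\<Sum>s\<in>T. \<bar>mass (rep F) s - mass (rep G) s\<bar>)"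
    by (intro sum.cong) (auto simp: law_mass[OF F rep(1)[OF F]] law_mass[OF G rep(1)[OF G]])
  also have "\<dots> \<le> 2 * L_dist M F G"
    unfolding L_dist_rep[OF F G] using \<open>finite T\<close> by (intro sum_mass_diff_le[OF rep(3) rep(3) rep(4)] F G)
  finally show "(\<Sum>s\<in>T. \<bar>law M S F s - law M S G s\<bar>) \<le> 2 * L_dist M F G" .
qed

lemma continuous_law: "continuous_map (L_topology M S) (realization_completion S UNIV) (law M S)"
  unfolding P.continuous_map_to_metric
proof (intro ballI allI impI)
  fix F and e :: real assume F: "F \<in> topspace (L_topology M S)" and e: "0 < e"
  then have FL: "F \<in> L_space M S" by simp
  show "\<exists>U. openin (L_topology M S) U \<and> F \<in> U \<and> (\<forall>G\<in>U. law M S G \<in> P.mball (law M S F) e)"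
  proof (intro exI[of _ "L.mball F (e/2)"] conjI ballI)
    fix G assume "G \<in> L.mball F (e/2)"
    then have G: "G \<in> L_space M S" and "L_dist M F G < e/2" by auto
    with l1_dist_law_le[OF FL G] have "l1_dist S (law M S F) (law M S G) < e" by simp
    then show "law M S G \<in> P.mball (law M S F) e" by (simp add: law_in_simplex FL G)
  qed (use FL e in auto)
qed

section \<open>Moving a class to a prescribed law\<close>

definition move :: "('w \<Rightarrow> 's) set \<Rightarrow> ('s \<Rightarrow> real) \<Rightarrow> ('w \<Rightarrow> 's) set" where
  "move F \<beta> = cls (transport (rep F) \<beta>)"

lemma
  assumes F: "F \<in> L_space M S" and \<beta>: "\<beta> \<in> prob_simplex S"
  shows move_in_L_space: "move F \<beta> \<in> L_space M S" and law_move: "law M S (move F \<beta>) = \<beta>"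
proof -
  note m = transport_measurable[OF rep(2)[OF F] \<beta>]
  show L: "move F \<beta> \<in> L_space M S" unfolding move_def by (rule cls_in_L_space[OF m])
  have "law M S (move F \<beta>) = restrict (mass (transport (rep F) \<beta>)) S"
    by (rule law_mass[OF L]) (simp add: move_def in_cls[OF m])
  also have "\<dots> = \<beta>"
    using simplexD(4)[OF \<beta>] by (auto simp: fun_eq_iff mass_transport[OF rep(2)[OF F] \<beta>] extensional_def)
  finally show "law M S (move F \<beta>) = \<beta>" .
qed

lemma move_law:
  assumes F: "F \<in> L_space M S"
  shows "move F (law M S F) = F"
  unfolding move_def
proof (rule cls_eqI[OF F rep(1)[OF F]])
  show "transport (rep F) (law M S F) \<in> M \<rightarrow>\<^sub>M count_space S"
    by (intro transport_measurable rep F law_in_simplex)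
  show "AE t in M. transport (rep F) (law M S F) t = rep F t"
    by (intro transport_own_mass rep F law_in_simplex) (simp add: law_mass[OF F rep(1)[OF F]])
qed

text \<open>The choice made by \<open>rep\<close> is harmless: the estimate for
  \<open>transport\<close> depends on the representatives only through the distance of their
  classes.\<close>

lemma continuous_move:
  "continuous_map (prod_topology (L_topology M S) (realization_completion S UNIV)) (L_topology M S)
     (\<lambda>(F, \<beta>). move F \<beta>)"
  unfolding L.continuous_map_to_metric
proof (intro ballI allI impI)
  fix z and e :: real
  assume "z \<in> topspace (prod_topology (L_topology M S) (realization_completion S UNIV))" and e: "0 < e"
  then obtain F \<beta> where z: "z = (F, \<beta>)" and F: "F \<in> L_space M S" and \<beta>: "\<beta> \<in> prob_simplex S"
    by auto
  have "0 < e / 4" using e by simp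
  then obtain T where T: "finite T" "T \<subseteq> S" "dist (sum \<beta> T) 1 \<le> e / 4"
    using has_sum_finite_approximation[OF simplexD(1)[OF \<beta>]] by blast
  \<comment> \<open>The bound for one slot becomes \<open>3 * d + 2 * d\<close>, so that the total
    is at most \<open>e/4 + 5 * e/8 < e\<close>. Adding 1 to the cardinality covers the empty
    \<open>T\<close>.\<close>
  define d where "d = e / (8 * (real (card T) + 1))"
  have d: "0 < d" using e by (simp add: d_def)
  have cd: "real (card T) * (5 * d) \<le> 5 * e / 8"
    using e by (simp add: d_def field_simps)
  show "\<exists>U. openin (prod_topology (L_topology M S) (realization_completion S UNIV)) U \<and> z \<in> U \<and>
      (\<forall>y\<in>U. (case y of (F, \<beta>) \<Rightarrow> move F \<beta>) \<in> L.mball (case z of (F, \<beta>) \<Rightarrow> move F \<beta>) e)"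
  proof (intro exI[of _ "L.mball F d \<times> P.mball \<beta> d"] conjI ballI)
    show "openin (prod_topology (L_topology M S) (realization_completion S UNIV)) (L.mball F d \<times> P.mball \<beta> d)"
      by (simp add: openin_prod_Times_iff)
    fix y assume "y \<in> L.mball F d \<times> P.mball \<beta> d"
    then obtain G \<gamma> where y: "y = (G, \<gamma>)" and G: "G \<in> L_space M S" "L_dist M F G < d"
        and \<gamma>: "\<gamma> \<in> prob_simplex S" "l1_dist S \<beta> \<gamma> < d" by auto
    have "L_dist M (move F \<beta>) (move G \<gamma>)
        = prob {t \<in> space M. transport (rep F) \<beta> t \<noteq> transport (rep G) \<gamma> t}"
      unfolding move_def by (intro L_dist_cls transport_measurable transport_countable_range rep F G \<beta> \<gamma>)
    also have "\<dots> \<le> (1 - sum \<beta> T) + card T * (3 * L_dist M F G + 2 * l1_dist S \<beta> \<gamma>)"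
      unfolding L_dist_rep[OF F G(1)] by (intro transport_diff_le rep F G \<beta> \<gamma> T)
    also have "\<dots> \<le> e / 4 + card T * (5 * d)"
    proof (intro add_mono mult_left_mono)
      show "1 - sum \<beta> T \<le> e / 4" using T(3) unfolding dist_real_def by linarith
    qed (use G(2) \<gamma>(2) in auto)
    also have "\<dots> < e" using cd e by linarith
    finally show "(case y of (F, \<beta>) \<Rightarrow> move F \<beta>) \<in> L.mball (case z of (F, \<beta>) \<Rightarrow> move F \<beta>) e"
      by (simp add: y z move_in_L_space F G \<beta> \<gamma>)
  qed (use z F \<beta> d in auto)
qed

section \<open>Splicing two classes along the label\<close>

definition splice :: "real \<Rightarrow> ('w \<Rightarrow> 's) set \<Rightarrow> ('w \<Rightarrow> 's) set \<Rightarrow> 'w \<Rightarrow> 's" where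
  "splice c F G x = (if u x \<le> c then rep F x else rep G x)"

definition mix :: "real \<Rightarrow> ('w \<Rightarrow> 's) set \<Rightarrow> ('w \<Rightarrow> 's) set \<Rightarrow> ('w \<Rightarrow> 's) set" where
  "mix c F G = cls (splice c F G)"

text \<open>The label need not be independent of \<open>F\<close> and \<open>G\<close>, so the law
  of a mix need not be a convex combination of their laws. The inclusion of supports takes its
  place.\<close>

lemma
  assumes F: "F \<in> L_space M S" and G: "G \<in> L_space M S"
  shows splice_measurable: "splice c F G \<in> M \<rightarrow>\<^sub>M count_space S"
    and splice_countable_range: "countable (splice c F G ` space M)"
    and mix_in_L_space: "mix c F G \<in> L_space M S"
    and mix_0: "mix 0 F G = G"
    and mix_1: "mix 1 F G = F"
    and mix_self: "mix c F F = F"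
    and law_mix_support: "law M S (mix c F G) s \<noteq> 0 \<Longrightarrow> s \<in> S \<Longrightarrow> law M S F s \<noteq> 0 \<or> law M S G s \<noteq> 0"
proof -
  note [measurable] = rep(3)[OF F] rep(3)[OF G]
  show m: "splice c F G \<in> M \<rightarrow>\<^sub>M count_space S" for c unfolding splice_def by measurable
  have "splice c F G ` space M \<subseteq> rep F ` space M \<union> rep G ` space M" by (auto simp: splice_def)
  then show "countable (splice c F G ` space M)"
    by (rule countable_subset) (simp add: rep F G)
  show L: "mix c F G \<in> L_space M S" unfolding mix_def by (rule cls_in_L_space[OF m])
  show "mix 0 F G = G" unfolding mix_def
    by (rule cls_eqI[OF G rep(1)[OF G] m], intro AE_I2) (auto simp: splice_def dest: label_range)
  show "mix 1 F G = F" unfolding mix_def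
    by (rule cls_eqI[OF F rep(1)[OF F] m], intro AE_I2) (auto simp: splice_def dest: label_range)
  have "splice c F F = rep F" by (auto simp: splice_def fun_eq_iff)
  then show "mix c F F = F" by (simp add: mix_def cls_rep F)
  assume s: "s \<in> S" and ne: "law M S (mix c F G) s \<noteq> 0"
  have "mass (splice c F G) s \<le> prob ({x \<in> space M. rep F x = s} \<union> {x \<in> space M. rep G x = s})"
    unfolding mass_def
    by (intro finite_measure_mono sets.Un sets_Collect_discrete[OF rep(3)] F G) (auto simp: splice_def)
  also have "\<dots> \<le> mass (rep F) s + mass (rep G) s"
    unfolding mass_def by (intro measure_Un_le sets_Collect_discrete[OF rep(3)] F G)
  finally have "mass (splice c F G) s \<le> mass (rep F) s + mass (rep G) s" .
  moreover have "mass (splice c F G) s > 0"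
    using ne s law_mass[OF L, of "splice c F G"] in_cls[OF m]
    by (simp add: mix_def mass_def zero_less_measure_iff)
  ultimately show "law M S F s \<noteq> 0 \<or> law M S G s \<noteq> 0"
    using s by (auto simp: law_mass[OF F rep(1)[OF F]] law_mass[OF G rep(1)[OF G]])
qed

text \<open>Two splices can differ only where the first classes differ, where the second ones
  differ, or where the label lies between the thresholds; the last has probability
  \<open>\<bar>c - c'\<bar>\<close> by uniformity.\<close>

lemma L_dist_mix_le:
  assumes F: "F \<in> L_space M S" "F' \<in> L_space M S" and G: "G \<in> L_space M S" "G' \<in> L_space M S"
    and c: "c \<in> {0..1}" "c' \<in> {0..1}"
  shows "L_dist M (mix c F G) (mix c' F' G') \<le> L_dist M F F' + L_dist M G G' + \<bar>c - c'\<bar>"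
proof -
  let ?D = "\<lambda>F G. {x \<in> space M. rep F x \<noteq> rep G x}"
  let ?I = "{x \<in> space M. min c c' < u x \<and> u x \<le> max c c'}"
  note ev = events_pred2[OF rep(3) rep(3) rep(4)]
  have I: "?I \<in> events" by measurable
  have "L_dist M (mix c F G) (mix c' F' G') = prob {x \<in> space M. splice c F G x \<noteq> splice c' F' G' x}"
    unfolding mix_def by (intro L_dist_cls splice_measurable splice_countable_range F G)
  also have "\<dots> \<le> prob ((?D F F' \<union> ?D G G') \<union> ?I)"
    by (intro finite_measure_mono sets.Un ev I F G) (auto simp: splice_def)
  also have "\<dots> \<le> prob (?D F F' \<union> ?D G G') + prob ?I"
    by (intro measure_Un_le sets.Un ev I F G)
  also have "prob (?D F F' \<union> ?D G G') \<le> L_dist M F F' + L_dist M G G'"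
    unfolding L_dist_rep[OF F] L_dist_rep[OF G] by (intro measure_Un_le ev F G)
  also have "prob ?I = \<bar>c - c'\<bar>" using c by (subst label_interval) auto
  finally show ?thesis by simp
qed

lemma continuous_mix:
  "continuous_map (prod_topology unit_interval (prod_topology (L_topology M S) (L_topology M S)))
     (L_topology M S) (\<lambda>(c, F, G). mix c F G)"
  unfolding L.continuous_map_to_metric
proof (intro ballI allI impI)
  let ?T = "prod_topology unit_interval (prod_topology (L_topology M S) (L_topology M S))"
  fix z and e :: real assume "z \<in> topspace ?T" and e: "0 < e"
  then obtain c F G where z: "z = (c, F, G)" and c: "c \<in> {0..1}"
      and F: "F \<in> L_space M S" and G: "G \<in> L_space M S" by auto
  show "\<exists>U. openin ?T U \<and> z \<in> U \<and>
      (\<forall>y\<in>U. (case y of (c, F, G) \<Rightarrow> mix c F G) \<in> L.mball (case z of (c, F, G) \<Rightarrow> mix c F G) e)"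
  proof (intro exI[of _ "({0..1} \<inter> ball c (e/3)) \<times> L.mball F (e/3) \<times> L.mball G (e/3)"] conjI ballI)
    show "openin ?T (({0..1} \<inter> ball c (e/3)) \<times> L.mball F (e/3) \<times> L.mball G (e/3))"
      by (simp add: openin_prod_Times_iff openin_open_Int)
    fix y assume "y \<in> ({0..1} \<inter> ball c (e/3)) \<times> L.mball F (e/3) \<times> L.mball G (e/3)"
    then obtain c' F' G' where y: "y = (c', F', G')" and c': "c' \<in> {0..1}" "\<bar>c - c'\<bar> < e/3"
        and F': "F' \<in> L_space M S" "L_dist M F F' < e/3" and G': "G' \<in> L_space M S" "L_dist M G G' < e/3"
      by (auto simp: dist_real_def)
    have "L_dist M (mix c F G) (mix c' F' G') < e"
      using L_dist_mix_le[OF F F'(1) G G'(1) c c'(1)] c'(2) F'(2) G'(2) by linarith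
    then show "(case y of (c, F, G) \<Rightarrow> mix c F G) \<in> L.mball (case z of (c, F, G) \<Rightarrow> mix c F G) e"
      by (simp add: y z mix_in_L_space F F' G G')
  qed (use z c F G e in auto)
qed

end


section \<open>The law map\<close>

context ordered_labels
begin

lemma L_space_nonempty:
  assumes "\<beta> \<in> prob_simplex S"
  shows "L_space M S \<noteq> {}"
proof -
  have "S \<noteq> {}" using infsumI[OF simplexD(1)[OF assms]] by auto
  then obtain s where "s \<in> S" by blast
  then have "(\<lambda>_. s) \<in> M \<rightarrow>\<^sub>M count_space S" by simp
  from cls_in_L_space[OF this] show ?thesis by blast
qed

text \<open>\<open>Q\<close> stands for the realization or for its completion. The hypothesis
  \<open>down\<close> keeps the homotopy in \<open>X\<close>: the two classes mixed at time
  \<open>c\<close> both have the law of \<open>G\<close>, so the support of the mix lies in that of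
  \<open>G\<close>.\<close>

lemma law_fibration:
  fixes Q :: "('s \<Rightarrow> real) set"
  assumes Q: "Q \<subseteq> prob_simplex S"
    and down: "\<forall>\<beta>\<in>Q. \<forall>\<gamma>\<in>prob_simplex S. {s \<in> S. \<gamma> s \<noteq> 0} \<subseteq> {s \<in> S. \<beta> s \<noteq> 0} \<longrightarrow> \<gamma> \<in> Q"
  defines "X \<equiv> subtopology (L_topology M S) {F \<in> L_space M S. law M S F \<in> Q}"
    and "Y \<equiv> subtopology (realization_completion S UNIV) Q"
  shows "homotopy_lifting Z X Y (law M S)"
    and "continuous_map X Y (law M S)"
    and "weak_homotopy_equivalence X Y (law M S)"
    and "homotopy_equivalence X Y (law M S)"
proof -
  have X: "topspace X = {F \<in> L_space M S. law M S F \<in> Q}" by (auto simp: X_def)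
  have Y: "topspace Y = Q" using Q by (auto simp: Y_def)
  have XL: "F \<in> L_space M S" "law M S F \<in> Q" if "F \<in> topspace X" for F using that X by auto
  show law: "continuous_map X Y (law M S)"
    unfolding X_def Y_def
    by (intro continuous_map_into_subtopology continuous_map_from_subtopology continuous_law) auto
  have move_X: "move F \<beta> \<in> topspace X" if "F \<in> L_space M S" "\<beta> \<in> Q" for F \<beta>
    using that Q by (auto simp: X move_in_L_space law_move)
  have from_X: "continuous_map W (L_topology M S) f" if "continuous_map W X f" for W :: "'c topology" and f
    using that unfolding X_def by (rule continuous_map_into_fulltopology)
  have into_X: "continuous_map W X f"
    if "continuous_map W (L_topology M S) f" "\<And>z. z \<in> topspace W \<Longrightarrow> f z \<in> topspace X" for W :: "'c topology" and f
    using that(2) unfolding X_def by (intro continuous_map_into_subtopology that(1)) auto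
  have move: "continuous_map (prod_topology X Y) X (\<lambda>(F, \<beta>). move F \<beta>)"
  proof (rule into_X)
    show "continuous_map (prod_topology X Y) (L_topology M S) (\<lambda>(F, \<beta>). move F \<beta>)"
      unfolding X_def Y_def prod_topology_subtopology
      by (intro continuous_map_from_subtopology continuous_move)
    show "(case z of (F, \<beta>) \<Rightarrow> move F \<beta>) \<in> topspace X" if "z \<in> topspace (prod_topology X Y)" for z
      using that move_X XL(1) by (auto simp: Y)
  qed
  have law_move': "law M S (move F \<beta>) = \<beta>" if "F \<in> topspace X" "\<beta> \<in> topspace Y" for F \<beta>
    using that Q by (auto simp: X Y law_move)
  have move_law': "move F (law M S F) = F" if "F \<in> topspace X" for F
    by (rule move_law[OF XL(1)[OF that]])
  show "homotopy_lifting Z X Y (law M S)"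
    by (rule homotopy_lifting_connection[where p = "law M S" and \<Phi> = move, OF move law_move' move_law'])
  have move_cont: "continuous_map Y X (move F)" if F: "F \<in> topspace X" for F
  proof -
    have "continuous_map Y (prod_topology X Y) (\<lambda>\<beta>. (F, \<beta>))"
      using F by (intro continuous_map_pairedI) auto
    from continuous_map_compose[OF this move] show ?thesis by (simp add: o_def)
  qed
  have homotopy: "homotopic_with (\<lambda>k. k F = F) X X (move F \<circ> law M S) id" if F: "F \<in> topspace X" for F
  proof (subst homotopic_with)
    let ?h = "\<lambda>(c, G). mix c G (move F (law M S G))"
    let ?TL = "L_topology M S"
    have "continuous_map (prod_topology unit_interval X) X ?h"
    proof (rule into_X)
      have fst: "continuous_map (prod_topology unit_interval X) unit_interval fst"
        and snd: "continuous_map (prod_topology unit_interval X) X snd"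
        by (rule continuous_map_fst continuous_map_snd)+
      have "continuous_map (prod_topology unit_interval X) X (\<lambda>z. move F (law M S (snd z)))"
        using continuous_map_compose[OF continuous_map_compose[OF snd law] move_cont[OF F]] by (simp add: o_def)
      then have "continuous_map (prod_topology unit_interval X) (prod_topology unit_interval (prod_topology ?TL ?TL))
          (\<lambda>z. (fst z, snd z, move F (law M S (snd z))))"
        by (intro continuous_map_pairedI fst from_X snd)
      from continuous_map_compose[OF this continuous_mix]
      show "continuous_map (prod_topology unit_interval X) ?TL ?h"
        by (simp add: o_def case_prod_unfold)
      have "mix c G (move F (law M S G)) \<in> topspace X" if G: "G \<in> topspace X" for c G
      proof -
        note GL = XL[OF G]
        have mL: "move F (law M S G) \<in> L_space M S" using move_X[OF XL(1)[OF F] GL(2)] XL by blast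
        have "law M S (move F (law M S G)) = law M S G" using GL F Q by (auto simp: X law_move)
        then have "{s \<in> S. law M S (mix c G (move F (law M S G))) s \<noteq> 0} \<subseteq> {s \<in> S. law M S G s \<noteq> 0}"
          using law_mix_support[OF GL(1) mL] by auto
        then show ?thesis
          unfolding X using down GL(2) mix_in_L_space[OF GL(1) mL] law_in_simplex by blast
      qed
      then show "?h z \<in> topspace X" if "z \<in> topspace (prod_topology unit_interval X)" for z
        using that by auto
    qed
    moreover have "?h (0, G) = (move F \<circ> law M S) G" "?h (1, G) = id G" if "G \<in> topspace X" for G
      using XL[OF that] move_X[OF XL(1)[OF F]] XL(1) by (simp_all add: mix_0 mix_1)
    moreover have "?h (c, F) = F" for c
      using XL(1)[OF F] by (simp add: move_law mix_self)
    ultimately show "\<exists>h. continuous_map (prod_topology unit_interval X) X h \<and>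
        (\<forall>x\<in>topspace X. h (0, x) = (move F \<circ> law M S) x) \<and>
        (\<forall>x\<in>topspace X. h (1, x) = id x) \<and> (\<forall>t\<in>{0..1}. h (t, F) = F)"
      by (intro exI[of _ ?h]) blast
  qed (use F in auto)
  have surj: "law M S ` topspace X = topspace Y"
  proof
    show "law M S ` topspace X \<subseteq> topspace Y" using XL(2) Y by auto
    show "topspace Y \<subseteq> law M S ` topspace X"
    proof
      fix \<beta> assume "\<beta> \<in> topspace Y"
      then have \<beta>: "\<beta> \<in> Q" "\<beta> \<in> prob_simplex S" using Y Q by auto
      obtain F where "F \<in> L_space M S" using L_space_nonempty[OF \<beta>(2)] by blast
      then show "\<beta> \<in> law M S ` topspace X"
        using move_X[of F \<beta>] law_move[of F \<beta>] \<beta> by (metis image_eqI)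
    qed
  qed
  show "weak_homotopy_equivalence X Y (law M S)"
    by (rule weak_homotopy_equivalence_pointed_sections[OF law surj move_cont law_move' move_law' homotopy])
  show "homotopy_equivalence X Y (law M S)"
  proof (cases "topspace X = {}")
    case True
    \<comment> \<open>There is no class to start a section from, but both spaces are empty and any
      function, here \<open>undefined\<close>, is an inverse.\<close>
    then have "topspace Y = {}" using surj by auto
    with True show ?thesis
      by (intro homotopy_equivalence_section[OF law, of undefined])
        (auto intro!: homotopic_with_equal continuous_map_on_empty simp: continuous_map_def)
  next
    case False
    then obtain F where F: "F \<in> topspace X" by blast
    show ?thesis
      by (rule homotopy_equivalence_section[OF law move_cont[OF F] law_move'[OF F]])
        (auto intro: homotopic_with_mono[OF homotopy[OF F]])
  qed
qed

section \<open>The complex and its closure as preimages under the law\<close>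

lemma realization_completion_set_subset_simplex: "realization_completion_set S K \<subseteq> prob_simplex S"
  by (auto simp: realization_completion_set_def)

lemma realization_completion_subtopology:
  "realization_completion S K = subtopology (realization_completion S UNIV) (realization_completion_set S K)"
proof -
  interpret Submetric "prob_simplex S" "l1_dist S" "realization_completion_set S K"
    by unfold_locales (rule realization_completion_set_subset_simplex)
  show ?thesis using mtopology_submetric by (simp add: realization_completion_def)
qed

lemma realization_subtopology:
  assumes "abstract_simplicial_complex S K"
  shows "realization S K = subtopology (realization_completion S UNIV) (realization_set S K)"
proof -
  interpret Submetric "prob_simplex S" "l1_dist S" "realization_set S K"
    by unfold_locales (use realization_set_subset[OF assms] realization_completion_set_subset_simplex in blast)
  show ?thesis using mtopology_submetric by (simp add: realization_completion_def realization_def)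
qed

lemma closedin_realization_completion_set:
  "closedin (realization_completion S UNIV) (realization_completion_set S K)"
proof -
  interpret Submetric "prob_simplex S" "l1_dist S" "realization_completion_set S K"
    by unfold_locales (rule realization_completion_set_subset_simplex)
  show ?thesis
    using mcomplete_imp_closedin[OF mcomplete_realization_completion]
    by (simp add: realization_completion_def)
qed

lemma ess_image_iff_law:
  assumes "F \<in> L_space M S"
  shows "ess_image M S F \<in> K \<longleftrightarrow> law M S F \<in> realization_set S K"
proof -
  have "ess_image M S F = {s \<in> S. law M S F s > 0}" by (auto simp: ess_image_def law_def)
  then show ?thesis
    using law_in_simplex[OF assms] by (auto simp: realization_set_def realization_completion_set_def)
qed

lemma L_cplx_law: "L_cplx M S K = subtopology (L_topology M S) {F \<in> L_space M S. law M S F \<in> realization_set S K}"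
  unfolding L_cplx_def by (rule arg_cong[where f = "subtopology _"]) (auto simp: ess_image_iff_law)

text \<open>The closure of the preimage is the preimage of the closure. One inclusion is continuity
  of the law. For the other, the section \<open>move F\<close> carries the closure of the
  realization into the closure of its preimage, and it carries the law of \<open>F\<close> to
  \<open>F\<close>.\<close>

lemma L_cplx_closure_law:
  assumes K: "abstract_simplicial_complex S K"
  shows "L_cplx_closure M S K
    = subtopology (L_topology M S) {F \<in> L_space M S. law M S F \<in> realization_completion_set S K}"
proof -
  let ?TL = "L_topology M S" and ?TP = "realization_completion S UNIV"
  let ?Q = "realization_set S K" and ?R = "realization_completion_set S K"
  let ?A = "{F \<in> L_space M S. law M S F \<in> ?Q}"
  have closure: "?TP closure_of ?Q = ?R"
  proof
    show "?TP closure_of ?Q \<subseteq> ?R"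
      by (intro closure_of_minimal realization_set_subset[OF K] closedin_realization_completion_set)
    show "?R \<subseteq> ?TP closure_of ?Q"
      using realization_dense[OF K] realization_set_subset[OF K]
      unfolding realization_completion_subtopology[of K] closure_of_subtopology by (simp add: Int_absorb1) blast
  qed
  have "?TL closure_of ?A = {F \<in> L_space M S. law M S F \<in> ?R}"
  proof
    show "?TL closure_of ?A \<subseteq> {F \<in> L_space M S. law M S F \<in> ?R}"
    proof
      fix F assume F: "F \<in> ?TL closure_of ?A"
      then have FL: "F \<in> L_space M S" using closure_of_subset_topspace[of ?TL ?A] by auto
      have "law M S F \<in> ?TP closure_of (law M S ` ?A)"
        using continuous_map_image_closure_subset[OF continuous_law, of ?A] F by blast
      also have "\<dots> \<subseteq> ?TP closure_of ?Q" by (rule closure_of_mono) auto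
      finally show "F \<in> {F \<in> L_space M S. law M S F \<in> ?R}" using FL closure by simp
    qed
    show "{F \<in> L_space M S. law M S F \<in> ?R} \<subseteq> ?TL closure_of ?A"
    proof
      fix F assume "F \<in> {F \<in> L_space M S. law M S F \<in> ?R}"
      then have F: "F \<in> L_space M S" "law M S F \<in> ?TP closure_of ?Q" using closure by auto
      have "continuous_map ?TP (prod_topology ?TL ?TP) (\<lambda>\<beta>. (F, \<beta>))"
        using F(1) by (intro continuous_map_pairedI) auto
      from continuous_map_compose[OF this continuous_move]
      have "continuous_map ?TP ?TL (move F)" by (simp add: o_def)
      from continuous_map_image_closure_subset[OF this, of ?Q]
      have "move F (law M S F) \<in> ?TL closure_of (move F ` ?Q)" using F(2) by blast
      also have "\<dots> \<subseteq> ?TL closure_of ?A"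
      proof (rule closure_of_mono, rule image_subsetI)
        fix \<beta> assume \<beta>: "\<beta> \<in> ?Q"
        then have "\<beta> \<in> prob_simplex S"
          using realization_set_subset[OF K] realization_completion_set_subset_simplex by blast
        with \<beta> show "move F \<beta> \<in> ?A" by (simp add: move_in_L_space law_move F(1))
      qed
      finally show "F \<in> ?TL closure_of ?A" by (simp add: move_law F(1))
    qed
  qed
  moreover have "{F \<in> L_space M S. ess_image M S F \<in> K} = ?A" by (auto simp: ess_image_iff_law)
  ultimately show ?thesis by (simp add: L_cplx_closure_def)
qed

lemma law_fibration_complex:
  assumes K: "abstract_simplicial_complex S K"
  shows "homotopy_lifting Z (L_cplx M S K) (realization S K) (law M S)"
    and "continuous_map (L_cplx M S K) (realization S K) (law M S)"
    and "weak_homotopy_equivalence (L_cplx M S K) (realization S K) (law M S)"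
    and "homotopy_equivalence (L_cplx M S K) (realization S K) (law M S)"
proof -
  have Q: "realization_set S K \<subseteq> prob_simplex S"
    using realization_set_subset[OF K] realization_completion_set_subset_simplex by blast
  have "\<gamma> \<in> realization_set S K"
    if \<beta>: "\<beta> \<in> realization_set S K" and \<gamma>: "\<gamma> \<in> prob_simplex S"
      and sub: "{s \<in> S. \<gamma> s \<noteq> 0} \<subseteq> {s \<in> S. \<beta> s \<noteq> 0}" for \<beta> \<gamma>
  proof -
    have pos: "{s \<in> S. \<delta> s > 0} = {s \<in> S. \<delta> s \<noteq> 0}" if "\<delta> \<in> prob_simplex S" for \<delta>
      using simplexD(3)[OF that] by (auto simp: order_less_le)
    \<comment> \<open>A complex is closed under nonempty subsets only; the total mass 1 excludes an
      empty support.\<close>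
    have "{s \<in> S. \<gamma> s > 0} \<noteq> {}"
    proof
      assume "{s \<in> S. \<gamma> s > 0} = {}"
      then have "\<gamma> s = 0" if "s \<in> S" for s using pos[OF \<gamma>] that by auto
      then have "(\<gamma> has_sum 0) S" by (simp add: has_sum_0)
      then show False using simplexD(1)[OF \<gamma>] has_sum_unique by fastforce
    qed
    moreover have "{s \<in> S. \<gamma> s > 0} \<subseteq> {s \<in> S. \<beta> s > 0}"
      using sub pos[OF \<gamma>] pos[of \<beta>] \<beta> Q by auto
    moreover have "{s \<in> S. \<beta> s > 0} \<in> K" using \<beta> by (simp add: realization_set_def)
    ultimately have "{s \<in> S. \<gamma> s > 0} \<in> K"
      using K unfolding abstract_simplicial_complex_def by metis
    then show ?thesis using \<gamma> by (simp add: realization_set_def realization_completion_set_def)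
  qed
  then have "\<forall>\<beta>\<in>realization_set S K. \<forall>\<gamma>\<in>prob_simplex S.
      {s \<in> S. \<gamma> s \<noteq> 0} \<subseteq> {s \<in> S. \<beta> s \<noteq> 0} \<longrightarrow> \<gamma> \<in> realization_set S K" by blast
  note fib = law_fibration[OF Q this]
  show "homotopy_lifting Z (L_cplx M S K) (realization S K) (law M S)"
    "continuous_map (L_cplx M S K) (realization S K) (law M S)"
    "weak_homotopy_equivalence (L_cplx M S K) (realization S K) (law M S)"
    "homotopy_equivalence (L_cplx M S K) (realization S K) (law M S)"
    unfolding L_cplx_law realization_subtopology[OF K]  by (fact fib)+
qed

lemma law_fibration_complex_closure:
  assumes K: "abstract_simplicial_complex S K"
  shows "homotopy_lifting Z (L_cplx_closure M S K) (realization_completion S K) (law M S)"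
    and "continuous_map (L_cplx_closure M S K) (realization_completion S K) (law M S)"
    and "weak_homotopy_equivalence (L_cplx_closure M S K) (realization_completion S K) (law M S)"
    and "homotopy_equivalence (L_cplx_closure M S K) (realization_completion S K) (law M S)"
proof -
  have "\<forall>\<beta>\<in>realization_completion_set S K. \<forall>\<gamma>\<in>prob_simplex S.
      {s \<in> S. \<gamma> s \<noteq> 0} \<subseteq> {s \<in> S. \<beta> s \<noteq> 0} \<longrightarrow> \<gamma> \<in> realization_completion_set S K"
  proof (intro ballI impI)
    fix \<beta> \<gamma> assume \<beta>: "\<beta> \<in> realization_completion_set S K" and \<gamma>: "\<gamma> \<in> prob_simplex S"
      and sub: "{s \<in> S. \<gamma> s \<noteq> 0} \<subseteq> {s \<in> S. \<beta> s \<noteq> 0}"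
    have "\<tau> \<in> K" if "\<tau> \<noteq> {}" "finite \<tau>" "\<tau> \<subseteq> {s \<in> S. \<gamma> s \<noteq> 0}" for \<tau>
      using \<beta> that(1,2) subset_trans[OF that(3) sub] by (simp add: realization_completion_set_def)
    then show "\<gamma> \<in> realization_completion_set S K"
      using \<gamma> by (simp add: realization_completion_set_def)
  qed
  note fib = law_fibration[OF realization_completion_set_subset_simplex this]
  show "homotopy_lifting Z (L_cplx_closure M S K) (realization_completion S K) (law M S)"
    "continuous_map (L_cplx_closure M S K) (realization_completion S K) (law M S)"
    "weak_homotopy_equivalence (L_cplx_closure M S K) (realization_completion S K) (law M S)"
    "homotopy_equivalence (L_cplx_closure M S K) (realization_completion S K) (law M S)"
    unfolding L_cplx_closure_law[OF K] realization_completion_subtopology[of K]  by (fact fib)+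
qed

end

theorem theorem4p7:
  fixes M :: "'w measure" and S :: "'s set" and K :: "'s set set"
  assumes "nonatomic_standard_prob_space M"
    and "abstract_simplicial_complex S K"
  shows "serre_fibration (L_cplx M S K) (realization S K) (law M S) \<and>
         weak_homotopy_equivalence (L_cplx M S K) (realization S K) (law M S) \<and>
         serre_fibration (L_cplx_closure M S K) (realization_completion S K) (law M S) \<and>
         weak_homotopy_equivalence (L_cplx_closure M S K) (realization_completion S K) (law M S) \<and>
         (finite K \<longrightarrow>
            hurewicz_fibration TYPE('z) (L_cplx M S K) (realization S K) (law M S) \<and>
            homotopy_equivalence (L_cplx M S K) (realization S K) (law M S) \<and>
            hurewicz_fibration TYPE('z) (L_cplx_closure M S K) (realization_completion S K) (law M S) \<and>
            homotopy_equivalence (L_cplx_closure M S K) (realization_completion S K) (law M S))"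
proof -
  obtain u A where label: "uniform_label M u A"
    using nonatomic_standard_prob_space_label[OF assms(1)] .
  obtain r :: "'s rel" where r: "Well_order r" "Field r = UNIV"
    using well_ordering[where 'a = 's] by (elim exE conjE)
  then have "trans r" "antisym r" "total r"
    by (simp_all add: well_order_on_def linear_order_on_def partial_order_on_def preorder_on_def)
  \<comment> \<open>The strict part of a well-order of the whole type serves as the linear order of
    the values.\<close>
  interpret ordered_labels M u A S "\<lambda>s s'. (s, s') \<in> r \<and> s \<noteq> s'"
  proof (intro ordered_labels.intro label ordered_labels_axioms.intro)
    show "(s, s'') \<in> r \<and> s \<noteq> s''" if "(s, s') \<in> r \<and> s \<noteq> s'" "(s', s'') \<in> r \<and> s' \<noteq> s''" for s s' s''
      using that \<open>trans r\<close> \<open>antisym r\<close> by (metis antisymD transD)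
  qed (use \<open>total r\<close> in \<open>auto simp: total_on_def\<close>)
  show ?thesis
    unfolding serre_fibration_def hurewicz_fibration_def
    by (intro conjI allI impI law_fibration_complex law_fibration_complex_closure assms(2))
qed

end
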